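(* Let $K\subset\mathbb{R}^n$ be open and let $\mathcal W=(\mathcal W_1,\dots,\mathcal W_s)$ be a finite tuple of operators of class $\mathcal O_K$. If $\mathcal W$ is regularly dependent at a point $(\bar x,\bar p)\in K\times\mathbb{R}^n$, then there exists a neighborhood $O\subset K\times\mathbb{R}^n$ of $(\bar x,\bar p)$ such that $\mathcal W$ is not quasi-independent at any point of $O$. In particular, $\mathcal W$ is not globally quasi-independent.
   Context: Operators. Let $\hat p_i:=\partial/\partial x_i$. An operator of class $\mathcal O_K$ is a real linear differential operator $\mathcal F=\sum_{|\alpha|\le m}A_\alpha(x)\hat p^\alpha$ with real $A_\alpha\in C^\infty(K)$, $\hat p^\alpha=\partial^{|\alpha|}/\partial x_1^{\alpha_1}\cdots\partial x_n^{\alpha_n}$; two operators are equal if they agree on every $\psi\in C^\infty(K)$ (the coefficients $A_\alpha$ are then uniquely determined). Its symbol is $F(x,p)=\sum_\alpha A_\alpha(x)p^\alpha$ on $K\times\mathbb{R}^n$. For $g\ge 0$, $H_g(\mathcal F):=\sum_{|\alpha|=g}A_\alpha\hat p^\alpha$ and $H_g(F)$ is its symbol. If $\mathcal F\neq0$, its order $\mathrm{ord}\,\mathcal F$ is the largest $m$ with $H_m(\mathcal F)\ne0$ and $MF:=H_m(F)$ is the main part of the symbol; if $\mathcal F=0$, $MF:=0$. Operators of order $0$ are multiplication by smooth functions. For a tuple $\mathcal W$, $MW:=(MW_1,\dots,MW_s):K\times\mathbb{R}^n\to\mathbb{R}^s$. $\mathcal W$ is quasi-independent at $(x,p)$ if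 $d(MW_1),\dots,d(MW_s)$ are linearly independent at $(x,p)$; globally quasi-independent if this holds at almost every point of $K\times\mathbb{R}^n$. Noncommutative polynomials. With commuting variables $G=(G_1,\dots,G_l)$ and noncommuting variables $F=(F_1,\dots,F_r)$, a monomial associated with a finite sequence $\beta=(\beta_1,\dots,\beta_q)$, $\beta_i\in\{1,\dots,r\}$, $q\ge0$, is a formal product $Z_0(G)F_{\beta_1}Z_1(G)\cdots F_{\beta_q}Z_q(G)$ with $Z_j\in C^\infty(\mathbb{R}^l)$, multilinear over $\mathbb R$ in the $Z_j$; a noncommutative polynomial $S=\sum_\beta S_\beta$ is a finite formal sum of monomials ($S_\beta$ collecting those associated with $\beta$), and $S=0$ iff every $S_\beta=0$. Its abelianization $S_C:\mathbb{R}^{l+r}\to\mathbb{R}$ is obtained by letting all variables commute (the monomial above gives $Z_0(G)\cdots Z_q(G)F_{\beta_1}\cdots F_{\beta_q}$). For weights $w=(w_1,\dots,w_r)$, $C_{d,w}(S):=\sum_{\beta:\sum_j w_{\beta_j}=d}S_\beta$; for $S\ne0$, $\deg_wS$ is the largest $d$ with $C_{d,w}(S)\ne0$ and $\mathcal M_wS:=C_{\deg_wS,w}(S)$ ($\mathcal M_w0:=0$). When a polynomial is evaluated on a tuple of class $\mathcal O_K$ operators, the operators of order $0$ are substituted for commuting variables (each $Z_j(G)$ becoming multiplication by $Z_j$ of those functions) and the others for noncommuting variables; $\mathcal M_{(\cdot)}S$ denotes the main part with weights $w_i=$ order of the operator substituted for $F_i$. Dependence. For tuples $\mathcal W=(\mathcal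 W_1,\dots,\mathcal W_s)$, $\mathcal Y=(\mathcal Y_1,\dots,\mathcal Y_r)$ and $(\bar W,\bar Y)=(MW,MY)(\bar x,\bar p)$: $\mathcal W$ is algebraically dependent on $\mathcal Y$ at $(\bar x,\bar p)$ if there are noncommutative polynomials $S_1,\dots,S_s$ in variables $(W,Y)$ corresponding to $(\mathcal W,\mathcal Y)$ with (1) $\det\big(\partial(\mathcal M_{(\mathcal W,\mathcal Y)}S_i)_C/\partial W_j\big)_{i,j=1}^s(\bar W,\bar Y)\ne0$ and (2) a neighborhood $H\subset K$ of $\bar x$ with $S_i(\mathcal W,\mathcal Y)\psi=0$ on $H$ for all $\psi\in C^\infty(H)$ and all $i$. $\mathcal W\sqsubseteq\mathcal Y$ at $(\bar x,\bar p)$ (algebraic containment) if there are tuples $\mathcal Z^{(1)},\dots,\mathcal Z^{(q)}$ ($q\ge 0$) with $\mathcal W$ algebraically dependent on $\mathcal Z^{(1)}$, $\mathcal Z^{(i)}$ on $\mathcal Z^{(i+1)}$, and $\mathcal Z^{(q)}$ on $\mathcal Y$ (for $q=0$: $\mathcal W$ on $\mathcal Y$), all at $(\bar x,\bar p)$. $\mathcal W$ (with $s$ operators) is regularly dependent at $(\bar x,\bar p)$ if $\mathcal W\sqsubseteq\mathcal Y$ at that point for some tuple $\mathcal Y$ of $r<s$ operators of class $\mathcal O_K$. *)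

theory Defs
  imports "HOL-Analysis.Analysis"
begin

definition pd :: "'n::finite \<Rightarrow> (real^'n \<Rightarrow> real) \<Rightarrow> real^'n \<Rightarrow> real" where
  "pd i f x = deriv (\<lambda>t. f (x + t *\<^sub>R axis i 1)) 0"

fun pdl :: "'n::finite list \<Rightarrow> (real^'n \<Rightarrow> real) \<Rightarrow> real^'n \<Rightarrow> real" where
  "pdl [] f = f"
| "pdl (i # is) f = pd i (pdl is f)"

definition smooth_on :: "(real^'n::finite) set \<Rightarrow> (real^'n \<Rightarrow> real) \<Rightarrow> bool" where
  "smooth_on K f \<longleftrightarrow>
     (\<forall>is. continuous_on K (pdl is f) \<and>
        (\<forall>i. \<forall>x\<in>K. (\<lambda>t. pdl is f (x + t *\<^sub>R axis i 1)) differentiable (at 0)))"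

text \<open>Multi-indices are functions 'n => nat; |alpha| and the mixed partial derivative p^alpha.
  For smooth functions the order of differentiation is irrelevant.\<close>
definition mi_abs :: "('n::finite \<Rightarrow> nat) \<Rightarrow> nat" where
  "mi_abs \<alpha> = (\<Sum>i\<in>UNIV. \<alpha> i)"

definition pdiff :: "('n::finite \<Rightarrow> nat) \<Rightarrow> (real^'n \<Rightarrow> real) \<Rightarrow> real^'n \<Rightarrow> real" where
  "pdiff \<alpha> f = pdl (SOME xs. \<forall>i. count_list xs i = \<alpha> i) f"

section \<open>Operators of class O_K, represented by their coefficient family A_alpha\<close>

type_synonym 'n dop = "('n \<Rightarrow> nat) \<Rightarrow> real^'n \<Rightarrow> real"

definition supp :: "(real^'n::finite) set \<Rightarrow> 'n dop \<Rightarrow> ('n \<Rightarrow> nat) set" where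
  "supp K A = {\<alpha>. \<exists>x\<in>K. A \<alpha> x \<noteq> 0}"

definition op_class :: "(real^'n::finite) set \<Rightarrow> 'n dop \<Rightarrow> bool" where
  "op_class K A \<longleftrightarrow> finite (supp K A) \<and> (\<forall>\<alpha>. smooth_on K (A \<alpha>))"

definition op_apply :: "(real^'n::finite) set \<Rightarrow> 'n dop \<Rightarrow> (real^'n \<Rightarrow> real) \<Rightarrow> real^'n \<Rightarrow> real" where
  "op_apply K A \<psi> x = (\<Sum>\<alpha>\<in>supp K A. A \<alpha> x * pdiff \<alpha> \<psi> x)"

definition ord :: "(real^'n::finite) set \<Rightarrow> 'n dop \<Rightarrow> nat" where
  "ord K A = (if supp K A = {} then 0 else Max (mi_abs ` supp K A))"

definition MF :: "(real^'n::finite) set \<Rightarrow> 'n dop \<Rightarrow> real^'n \<Rightarrow> real^'n \<Rightarrow> real" where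
  "MF K A x p = (\<Sum>\<alpha>\<in>{\<alpha>\<in>supp K A. mi_abs \<alpha> = ord K A}. A \<alpha> x * (\<Prod>i\<in>UNIV. (p $ i) ^ \<alpha> i))"

definition quasi_indep ::
  "(real^'n::finite) set \<Rightarrow> nat \<Rightarrow> (nat \<Rightarrow> 'n dop) \<Rightarrow> real^'n \<Rightarrow> real^'n \<Rightarrow> bool" where
  "quasi_indep K s W x p \<longleftrightarrow>
     (\<forall>c :: nat \<Rightarrow> real.
        (\<forall>v. (\<Sum>i<s. c i * frechet_derivative (\<lambda>z. MF K (W i) (fst z) (snd z)) (at (x, p)) v) = 0)
        \<longrightarrow> (\<forall>i<s. c i = 0))"

definition glob_quasi_indep :: "(real^'n::finite) set \<Rightarrow> nat \<Rightarrow> (nat \<Rightarrow> 'n dop) \<Rightarrow> bool" where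
  "glob_quasi_indep K s W \<longleftrightarrow>
     (AE z in lborel. z \<in> K \<times> UNIV \<longrightarrow> quasi_indep K s W (fst z) (snd z))"

text \<open>Variables are indexed by natural numbers 0..<N (commuting and noncommuting alike);
  a point of the variable space is a function nat => real.  A monomial
  Z_0(G) F_b1 Z_1(G) ... F_bq Z_q(G) is the pair (beta, [Z_0,...,Z_q]); a polynomial is a
  finite formal sum, i.e. a list of monomials.\<close>

type_synonym mono = "nat list \<times> ((nat \<Rightarrow> real) \<Rightarrow> real) list"
type_synonym ncpoly = "mono list"

definition vpd :: "nat \<Rightarrow> ((nat \<Rightarrow> real) \<Rightarrow> real) \<Rightarrow> (nat \<Rightarrow> real) \<Rightarrow> real" where
  "vpd k f v = deriv (\<lambda>t. f (v(k := v k + t))) 0"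

fun vpdl :: "nat list \<Rightarrow> ((nat \<Rightarrow> real) \<Rightarrow> real) \<Rightarrow> (nat \<Rightarrow> real) \<Rightarrow> real" where
  "vpdl [] f = f"
| "vpdl (k # ks) f = vpd k (vpdl ks f)"

text \<open>Z is a C^infinity function of the (finitely many) variables in V only
  (continuity w.r.t. the product topology, equivalent to continuity on R^V here).\<close>
definition smooth_fin :: "nat set \<Rightarrow> ((nat \<Rightarrow> real) \<Rightarrow> real) \<Rightarrow> bool" where
  "smooth_fin V Z \<longleftrightarrow> finite V \<and>
     (\<forall>v v'. (\<forall>k\<in>V. v k = v' k) \<longrightarrow> Z v = Z v') \<and>
     (\<forall>ks. set ks \<subseteq> V \<longrightarrow> continuous_on UNIV (vpdl ks Z) \<and>
        (\<forall>k\<in>V. \<forall>v. (\<lambda>t. vpdl ks Z (v(k := v k + t))) differentiable (at 0)))"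

definition wf_poly :: "nat \<Rightarrow> (nat \<Rightarrow> bool) \<Rightarrow> ncpoly \<Rightarrow> bool" where
  "wf_poly N comm S \<longleftrightarrow>
     (\<forall>m\<in>set S. length (snd m) = Suc (length (fst m)) \<and>
        (\<forall>k\<in>set (fst m). k < N \<and> \<not> comm k) \<and>
        (\<forall>Z\<in>set (snd m). smooth_fin {k. k < N \<and> comm k} Z))"

text \<open>S_beta = 0 in the tensor product C^oo(R^l)^{(q+1)}: the associated function on (R^l)^{q+1} vanishes.\<close>
definition part_zero :: "ncpoly \<Rightarrow> nat list \<Rightarrow> bool" where
  "part_zero S \<beta> \<longleftrightarrow>
     (\<forall>g :: nat \<Rightarrow> nat \<Rightarrow> real.
        (\<Sum>m\<leftarrow>filter (\<lambda>m. fst m = \<beta>) S. \<Prod>j<length (snd m). (snd m ! j) (g j)) = 0)"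

definition pzero :: "ncpoly \<Rightarrow> bool" where
  "pzero S \<longleftrightarrow> (\<forall>\<beta>. part_zero S \<beta>)"

definition wt :: "(nat \<Rightarrow> nat) \<Rightarrow> nat list \<Rightarrow> nat" where
  "wt w \<beta> = sum_list (map w \<beta>)"

definition Cdw :: "nat \<Rightarrow> (nat \<Rightarrow> nat) \<Rightarrow> ncpoly \<Rightarrow> ncpoly" where
  "Cdw d w S = filter (\<lambda>m. wt w (fst m) = d) S"

definition deg_w :: "(nat \<Rightarrow> nat) \<Rightarrow> ncpoly \<Rightarrow> nat" where
  "deg_w w S = (GREATEST d. \<not> pzero (Cdw d w S))"

definition Mw :: "(nat \<Rightarrow> nat) \<Rightarrow> ncpoly \<Rightarrow> ncpoly" where
  "Mw w S = (if pzero S then [] else Cdw (deg_w w S) w S)"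

definition abel :: "ncpoly \<Rightarrow> (nat \<Rightarrow> real) \<Rightarrow> real" where
  "abel S v = (\<Sum>m\<leftarrow>S. (\<Prod>Z\<leftarrow>snd m. Z v) * (\<Prod>k\<leftarrow>fst m. v k))"

text \<open>The commuting variable k is replaced by the function by which the order-0 operator ops k
  multiplies, i.e. its coefficient A_0.\<close>
definition gvals :: "(nat \<Rightarrow> 'n::finite dop) \<Rightarrow> real^'n \<Rightarrow> nat \<Rightarrow> real" where
  "gvals ops x k = ops k (\<lambda>_. 0) x"

fun mono_apply :: "(real^'n::finite) set \<Rightarrow> (nat \<Rightarrow> 'n dop) \<Rightarrow> nat list \<Rightarrow> ((nat \<Rightarrow> real) \<Rightarrow> real) list
    \<Rightarrow> (real^'n \<Rightarrow> real) \<Rightarrow> real^'n \<Rightarrow> real" where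
  "mono_apply K ops [] Zs \<psi> x = (case Zs of [] \<Rightarrow> \<psi> x | Z # _ \<Rightarrow> Z (gvals ops x) * \<psi> x)"
| "mono_apply K ops (b # bs) Zs \<psi> x =
     (case Zs of [] \<Rightarrow> 0 | Z # Zs' \<Rightarrow>
        Z (gvals ops x) * op_apply K (ops b) (mono_apply K ops bs Zs' \<psi>) x)"

definition poly_apply :: "(real^'n::finite) set \<Rightarrow> (nat \<Rightarrow> 'n dop) \<Rightarrow> ncpoly
    \<Rightarrow> (real^'n \<Rightarrow> real) \<Rightarrow> real^'n \<Rightarrow> real" where
  "poly_apply K ops S \<psi> x = (\<Sum>m\<leftarrow>S. mono_apply K ops (fst m) (snd m) \<psi> x)"

definition detn :: "nat \<Rightarrow> (nat \<Rightarrow> nat \<Rightarrow> real) \<Rightarrow> real" where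
  "detn s M = (\<Sum>\<pi> | \<pi> permutes {..<s}. of_int (sign \<pi>) * (\<Prod>i<s. M i (\<pi> i)))"

definition tcat :: "nat \<Rightarrow> (nat \<Rightarrow> 'a) \<Rightarrow> (nat \<Rightarrow> 'a) \<Rightarrow> nat \<Rightarrow> 'a" where
  "tcat s W Y k = (if k < s then W k else Y (k - s))"

definition alg_dep :: "(real^'n::finite) set \<Rightarrow> nat \<Rightarrow> (nat \<Rightarrow> 'n dop) \<Rightarrow> nat \<Rightarrow> (nat \<Rightarrow> 'n dop)
    \<Rightarrow> real^'n \<Rightarrow> real^'n \<Rightarrow> bool" where
  "alg_dep K s W r Y x p \<longleftrightarrow>
     (let ops = tcat s W Y;
          comm = (\<lambda>k. ord K (ops k) = 0);
          w = (\<lambda>k. ord K (ops k));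
          vbar = (\<lambda>k. MF K (ops k) x p)
      in \<exists>S :: nat \<Rightarrow> ncpoly.
           (\<forall>i<s. wf_poly (s + r) comm (S i)) \<and>
           detn s (\<lambda>i j. vpd j (abel (Mw w (S i))) vbar) \<noteq> 0 \<and>
           (\<exists>H. open H \<and> x \<in> H \<and> H \<subseteq> K \<and>
              (\<forall>\<psi>. smooth_on H \<psi> \<longrightarrow> (\<forall>i<s. \<forall>y\<in>H. poly_apply K ops (S i) \<psi> y = 0))))"

definition alg_contained :: "(real^'n::finite) set \<Rightarrow> nat \<Rightarrow> (nat \<Rightarrow> 'n dop) \<Rightarrow> nat \<Rightarrow> (nat \<Rightarrow> 'n dop)
    \<Rightarrow> real^'n \<Rightarrow> real^'n \<Rightarrow> bool" where
  "alg_contained K s W r Y x p \<longleftrightarrow>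
     (\<exists>ts :: (nat \<times> (nat \<Rightarrow> 'n dop)) list.
        (\<forall>t\<in>set ts. \<forall>k<fst t. op_class K (snd t k)) \<and>
        (let ch = (s, W) # ts @ [(r, Y)] in
          \<forall>i<length ts + 1.
            alg_dep K (fst (ch ! i)) (snd (ch ! i)) (fst (ch ! Suc i)) (snd (ch ! Suc i)) x p))"

definition reg_dep :: "(real^'n::finite) set \<Rightarrow> nat \<Rightarrow> (nat \<Rightarrow> 'n dop) \<Rightarrow> real^'n \<Rightarrow> real^'n \<Rightarrow> bool" where
  "reg_dep K s W x p \<longleftrightarrow>
     (\<exists>r Y. r < s \<and> (\<forall>k<r. op_class K (Y k)) \<and> alg_contained K s W r Y x p)"

end

theory Submission
  imports Defs "Jordan_Normal_Form.Determinant"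
begin

text \<open>
  Apply a relation \<open>S(W, Y) = 0\<close> to the exponentials \<open>exp (t (p . x))\<close>. The result is the
  exponential times a polynomial in \<open>t\<close>, and its coefficient at the power \<open>deg S\<close> is the
  abelianized main part of \<open>S\<close> evaluated at the main symbols \<open>(MW, MY)(x, p)\<close>, which therefore
  vanishes near the given point. Differentiating this identity and using that the determinant
  stays nonzero nearby puts every \<open>d(MW i)\<close> in the span of the \<open>d(MY k)\<close>. Spans compose along a
  chain of dependences, so \<open>s\<close> differentials lie in the span of \<open>r < s\<close> vectors on an open set.
\<close>

section \<open>Linear algebra\<close>

text \<open>Conjugation by exp (t (p . x)) turns d/dx_i into d/dx_i + t p_i. An operator of order m
  therefore contributes t^m times its main symbol plus lower powers of t. Derivatives that fall on
  coefficients, the source of all commutators, cost a power of t, so the order of the factors is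
  invisible at the top power: this is why the abelianization appears. As p is a free parameter of
  the test functions, the resulting relation holds on an open set of pairs (x, p) and can be
  differentiated in both arguments. Two obstacles shape the proof. The degree is defined modulo
  formal vanishing in a tensor product, while a polynomial is stored as a list: monomials above the
  degree may be present and cancel only jointly, so they must be shown to act as zero before a top
  coefficient can be read off. And the variable space carries the product topology instead of a
  norm, so the chain rule is derived from continuous partial derivatives.\<close>

lemma detn_nonzero_imp_in_span:
  fixes g :: "nat \<Rightarrow> 'a::real_vector"
  assumes det: "detn s M \<noteq> 0" and sp: "\<And>i. i < s \<Longrightarrow> (\<Sum>j<s. M i j *\<^sub>R g j) \<in> span T"
    and "k < s"
  shows "g k \<in> span T"
proof -
  define A where "A = Matrix.mat s s (\<lambda>(i, j). M i j)"
  have A: "A \<in> carrier_mat s s" by (simp add: A_def)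
  have "Determinant.det A = detn s M"
    unfolding Determinant.det_def detn_def A_def
    by (auto simp: atLeast0LessThan dest: permutes_in_image intro!: sum.cong prod.cong)
  then have d: "Determinant.det A \<noteq> 0" using det by simp
  \<comment> \<open>Row \<open>k\<close> of the adjugate combines the \<open>s\<close> given vectors
    of the span into \<open>det A\<close> times \<open>g k\<close>, which is then divided by the
    nonzero determinant.\<close>
  define B where "B = adj_mat A"
  have B: "B \<in> carrier_mat s s" "B * A = Determinant.det A \<cdot>\<^sub>m 1\<^sub>m s"
    using adj_mat[OF A] by (auto simp: B_def)
  have BM: "(\<Sum>i<s. B $$ (k, i) * M i j) = (if j = k then Determinant.det A else 0)" if "j < s" for j
  proof -
    have "(B * A) $$ (k, j) = (\<Sum>i<s. B $$ (k, i) * M i j)"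
      using B(1) A that \<open>k < s\<close>
      by (simp add: scalar_prod_def atLeast0LessThan) (simp add: A_def)
    then show ?thesis using that \<open>k < s\<close> by (auto simp: B(2))
  qed
  have "(\<Sum>i<s. B $$ (k, i) *\<^sub>R (\<Sum>j<s. M i j *\<^sub>R g j)) = (\<Sum>j<s. (\<Sum>i<s. B $$ (k, i) * M i j) *\<^sub>R g j)"
    unfolding scaleR_sum_right scaleR_sum_left scaleR_scaleR by (rule sum.swap)
  also have "\<dots> = (\<Sum>j<s. if j = k then Determinant.det A *\<^sub>R g j else 0)"
    by (intro sum.cong) (auto simp: BM)
  also have "\<dots> = Determinant.det A *\<^sub>R g k" using \<open>k < s\<close> by simp
  finally have "Determinant.det A *\<^sub>R g k \<in> span T"
    using sp by (metis (no_types, lifting) lessThan_iff span_scale span_sum)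
  then show ?thesis using d span_scale[of "Determinant.det A *\<^sub>R g k" T "inverse (Determinant.det A)"] by simp
qed

text \<open>\<open>dependent\<close> speaks of sets, where a repetition in the family would be lost.
  An injective family is handled by counting dimensions; a repeated vector gives a relation with
  coefficients 1 and -1.\<close>

lemma ex_linear_dependence_in_span:
  fixes g :: "nat \<Rightarrow> 'a::real_vector"
  assumes "finite T" "card T < s" "\<And>i. i < s \<Longrightarrow> g i \<in> span T"
  shows "\<exists>c :: nat \<Rightarrow> real. (\<exists>i<s. c i \<noteq> 0) \<and> (\<Sum>i<s. c i *\<^sub>R g i) = 0"
proof (cases "inj_on g {..<s}")
  case True
  have "dependent (g ` {..<s})"
  proof (rule ccontr)
    assume "independent (g ` {..<s})"
    then have "card (g ` {..<s}) \<le> card T"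
      using independent_span_bound[OF assms(1)] assms(3) by blast
    then show False using card_image[OF True] assms(2) by simp
  qed
  then obtain u where u: "\<exists>v\<in>g ` {..<s}. u v \<noteq> 0" "(\<Sum>v\<in>g ` {..<s}. u v *\<^sub>R v) = 0"
    by (subst (asm) dependent_finite) auto
  then show ?thesis
    using sum.reindex[OF True, of "\<lambda>v. u v *\<^sub>R v"] by (intro exI[of _ "u \<circ> g"]) auto
next
  case False
  then obtain i j where ij: "i < s" "j < s" "i \<noteq> j" "g i = g j" by (auto simp: inj_on_def)
  define c :: "nat \<Rightarrow> real" where "c k = (if k = i then 1 else 0) - (if k = j then 1 else 0)" for k
  have "c k *\<^sub>R g k = (if k = i then g k else 0) - (if k = j then g k else 0)" for k
    by (simp add: c_def)
  then have "(\<Sum>k<s. c k *\<^sub>R g k) = 0"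
    using ij by (simp add: sum_subtractf)
  moreover have "c i \<noteq> 0" using ij by (simp add: c_def)
  ultimately show ?thesis using ij(1) by blast
qed

text \<open>Represents differentials by vectors, so that spans and dimension counts apply to
  them.\<close>

lemma linear_functional_eq_inner:
  fixes D :: "'a::euclidean_space \<Rightarrow> real"
  assumes "linear D"
  shows "D v = inner (\<Sum>b\<in>Basis. D b *\<^sub>R b) v"
proof -
  have "D v = D (\<Sum>b\<in>Basis. inner v b *\<^sub>R b)" by (simp add: euclidean_representation)
  also have "\<dots> = (\<Sum>b\<in>Basis. inner v b * D b)"
    using assms by (simp add: linear_sum linear_cmul)
  finally show ?thesis by (simp add: inner_sum_left inner_commute[of v] mult.commute)
qed

section \<open>The chain rule for functions with continuous partial derivatives\<close>

lemma tendsto_fun_coordinatewise: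
  fixes f :: "'a \<Rightarrow> 'k \<Rightarrow> 'b::topological_space"
  assumes "\<And>k. ((\<lambda>x. f x k) \<longlongrightarrow> l k) F"
  shows "(f \<longlongrightarrow> l) F"
proof -
  have "limitin (product_topology (\<lambda>_. euclidean) UNIV) f l F"
    using assms by (subst limitin_componentwise) auto
  then show ?thesis
    by (simp add: euclidean_product_topology)
qed

text \<open>Since \<open>'k \<Rightarrow> real\<close> has only the product topology, no Frechet
  derivative of \<open>F\<close> itself is used, just its continuous partial derivatives. The
  coordinates in \<open>A\<close> are released one at a time from their frozen value at
  \<open>z0\<close>, and each release is a two-variable problem. The open set \<open>N\<close>
  admits functions that are differentiable only on part of the space.\<close>

lemma has_derivative_compose_partials:
  fixes F :: "('k \<Rightarrow> real) \<Rightarrow> real" and V :: "'k \<Rightarrow> 'a::real_normed_vector \<Rightarrow> real"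
  assumes "finite A" and dep: "\<And>u v. (\<forall>k\<in>A. u k = v k) \<Longrightarrow> F u = F v"
    and N: "open N" "(\<lambda>k. V k z0) \<in> N"
    and der: "\<And>k v. k \<in> A \<Longrightarrow> v \<in> N \<Longrightarrow> ((\<lambda>t. F (v(k:=t))) has_real_derivative G k v) (at (v k))"
    and cont: "\<And>k. k \<in> A \<Longrightarrow> continuous_on N (G k)"
    and V: "\<And>k. k \<in> A \<Longrightarrow> (V k has_derivative V' k) (at z0)"
  shows "((\<lambda>z. F (\<lambda>k. V k z)) has_derivative (\<lambda>h. \<Sum>k\<in>A. G k (\<lambda>k. V k z0) * V' k h)) (at z0)"
proof -
  define v0 where "v0 = (\<lambda>k. V k z0)"
  \<comment> \<open>The coordinates in \<open>B\<close> move with \<open>z\<close>, all others are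
    frozen at \<open>z0\<close>. The empty \<open>B\<close> gives a constant function, and
    \<open>B = A\<close> gives the claim because \<open>F\<close> ignores the rest.\<close>
  have "((\<lambda>z. F (\<lambda>k. if k \<in> B then V k z else v0 k)) has_derivative (\<lambda>h. \<Sum>k\<in>B. G k v0 * V' k h)) (at z0)"
    if "finite B" "B \<subseteq> A" for B
    using that
  proof (induction B rule: finite_induct)
    case empty
    then show ?case by simp
  next
    case (insert a B)
    then have aA: "a \<in> A" by auto
    \<comment> \<open>The new coordinate \<open>a\<close> is separated as an independent real
      variable \<open>y\<close>; substituting \<open>y = V a z\<close> later recovers the function
      for \<open>insert a B\<close>.\<close>
    define u where "u x y = (\<lambda>k. if k = a then y else if k \<in> B then V k x else v0 k)" for x y
    have ulim: "((\<lambda>q. u (fst q) (snd q)) \<longlongrightarrow> v0) (nhds (z0, v0 a))"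
    proof (rule tendsto_fun_coordinatewise)
      fix k
      consider "k = a" | "k \<noteq> a" "k \<in> B" | "k \<noteq> a" "k \<notin> B" by blast
      then show "((\<lambda>q. u (fst q) (snd q) k) \<longlongrightarrow> v0 k) (nhds (z0, v0 a))"
      proof cases
        case 1
        have "((\<lambda>q. snd q) \<longlongrightarrow> snd (z0, v0 a)) (nhds (z0, v0 a))"
          by (intro tendsto_snd) (simp add: filterlim_ident)
        then show ?thesis using 1 by (simp add: u_def)
      next
        case 2
        then have "isCont (V k) z0"
          using V insert.prems by (meson has_derivative_continuous subsetD insertI2)
        then have "(V k \<longlongrightarrow> V k z0) (nhds z0)"
          using tendsto_at_iff_tendsto_nhds isCont_def by blast
        moreover have "((\<lambda>q. fst q) \<longlongrightarrow> fst (z0, v0 a)) (nhds (z0, v0 a))"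
          by (intro tendsto_fst) (simp add: filterlim_ident)
        ultimately have "((\<lambda>q. V k (fst q)) \<longlongrightarrow> V k z0) (nhds (z0, v0 a))"
          by (simp add: filterlim_compose)
        then show ?thesis using 2 by (simp add: u_def v0_def)
      next
        case 3
        then show ?thesis by (simp add: u_def)
      qed
    qed
    have "eventually (\<lambda>v. v \<in> N) (nhds v0)"
      using N unfolding v0_def by (simp add: eventually_nhds_in_open)
    with ulim have "eventually (\<lambda>q. u (fst q) (snd q) \<in> N) (nhds (z0, v0 a))"
      by (auto simp: filterlim_iff)
    then obtain S where S: "open S" "(z0, v0 a) \<in> S" "\<And>q. q \<in> S \<Longrightarrow> u (fst q) (snd q) \<in> N"
      unfolding eventually_nhds by blast
    obtain X Y0 where XY0: "open X" "open Y0" "z0 \<in> X" "v0 a \<in> Y0" "X \<times> Y0 \<subseteq> S"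
      using open_prod_elim[OF S(1,2)] by (metis mem_Sigma_iff)
    \<comment> \<open>A ball is taken because \<open>has_derivative_partialsI\<close> asks for a
      convex domain of the second variable.\<close>
    obtain e where e: "e > 0" "ball (v0 a) e \<subseteq> Y0"
      using XY0 openE by blast
    define Y where "Y = ball (v0 a) e"
    have uN: "u x y \<in> N" if "x \<in> X" "y \<in> Y" for x y
    proof -
      have "(x, y) \<in> S" using XY0(5) e(2) that unfolding Y_def by blast
      then show ?thesis using S(3)[of "(x,y)"] by simp
    qed
    have fy: "((\<lambda>y. F (u x y)) has_derivative blinfun_apply (blinfun_scaleR_left (G a (u x y)))) (at y within Y)"
      if "x \<in> X" "y \<in> Y" for x y
    proof -
      have "((\<lambda>t. F ((u x y)(a:=t))) has_real_derivative G a (u x y)) (at (u x y a))"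
        using der[OF aA uN[OF that]] .
      moreover have "(u x y)(a:=t) = u x t" for t by (auto simp: u_def)
      moreover have "u x y a = y" by (simp add: u_def)
      ultimately have "((\<lambda>y. F (u x y)) has_real_derivative G a (u x y)) (at y)" by simp
      then show ?thesis
        unfolding has_field_derivative_def
        by (auto intro!: has_derivative_at_withinI simp: fun_eq_iff mult.commute elim!: back_subst[of "\<lambda>d. (_ has_derivative d) _"])
    qed
    have uz: "u z0 (v0 a) = v0"
      by (auto simp: u_def v0_def)
    have v0N: "v0 \<in> N" using N by (simp add: v0_def)
    have "(G a \<longlongrightarrow> G a v0) (nhds v0)"
      using cont[OF aA] N(1) v0N
      by (metis at_within_open continuous_on_def tendsto_at_iff_tendsto_nhds)
    from filterlim_compose[OF this ulim]
    have Gl: "((\<lambda>q. G a (u (fst q) (snd q))) \<longlongrightarrow> G a v0) (at (z0, v0 a) within X \<times> Y)"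
      by (rule filterlim_mono) (auto simp: at_within_def intro: le_infI1)
    have cfy: "continuous (at (z0, v0 a) within X \<times> Y) (\<lambda>(x, y). blinfun_scaleR_left (G a (u x y)) :: real \<Rightarrow>\<^sub>L real)"
      unfolding continuous_within case_prod_beta
      using bounded_linear.tendsto[OF bounded_linear_blinfun_scaleR_left Gl] by (simp add: uz)
    have fx: "((\<lambda>x. F (u x (v0 a))) has_derivative (\<lambda>h. \<Sum>k\<in>B. G k v0 * V' k h)) (at z0 within X)"
    proof -
      have "(\<lambda>x. F (u x (v0 a))) = (\<lambda>z. F (\<lambda>k. if k \<in> B then V k z else v0 k))"
        using insert.hyps by (intro ext arg_cong[of _ _ F]) (auto simp: u_def)
      then show ?thesis
        using insert by (auto intro: has_derivative_at_withinI)
    qed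
    have "v0 a \<in> Y" "convex Y" "open Y" using e by (auto simp: Y_def)
    from has_derivative_partialsI[OF fx fy cfy this(1,2)]
    have D: "((\<lambda>(x, y). F (u x y)) has_derivative
        (\<lambda>(tx, ty). (\<Sum>k\<in>B. G k v0 * V' k tx) + ty * G a v0)) (at (z0, v0 a))"
      using XY0 \<open>v0 a \<in> Y\<close> \<open>open Y\<close> by (simp add: uz at_within_open[of _ "X \<times> Y"] open_Times)
    have "((\<lambda>z. (z, V a z)) has_derivative (\<lambda>h. (h, V' a h))) (at z0)"
      by (intro has_derivative_Pair V aA has_derivative_ident)
    from has_derivative_compose[OF this, of "\<lambda>(x, y). F (u x y)" "\<lambda>(tx, ty). (\<Sum>k\<in>B. G k v0 * V' k tx) + ty * G a v0"] D
    have "((\<lambda>z. F (u z (V a z))) has_derivative (\<lambda>h. (\<Sum>k\<in>B. G k v0 * V' k h) + V' a h * G a v0)) (at z0)"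
      by (simp add: v0_def)
    moreover have "u z (V a z) = (\<lambda>k. if k \<in> insert a B then V k z else v0 k)" for z
      by (auto simp: u_def)
    ultimately show ?case
      using insert.hyps by (simp add: add.commute mult.commute)
  qed
  from this[OF \<open>finite A\<close> order_refl]
  have "((\<lambda>z. F (\<lambda>k. if k \<in> A then V k z else v0 k)) has_derivative (\<lambda>h. \<Sum>k\<in>A. G k v0 * V' k h)) (at z0)" .
  moreover have "F (\<lambda>k. if k \<in> A then V k z else v0 k) = F (\<lambda>k. V k z)" for z
    by (rule dep) auto
  ultimately show ?thesis by (simp add: v0_def)
qed

section \<open>Smooth functions\<close>

text \<open>\<open>pd\<close> is total, being defined by \<open>deriv\<close>, and says nothing
  about existence. This relation asserts existence together with the value, so the usual rules of
  differentiation transfer.\<close>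

definition has_pd :: "'n::finite \<Rightarrow> (real^'n \<Rightarrow> real) \<Rightarrow> real \<Rightarrow> real^'n \<Rightarrow> bool" where
  "has_pd i f D x \<longleftrightarrow> ((\<lambda>t. f (x + t *\<^sub>R axis i 1)) has_real_derivative D) (at 0)"

lemma has_pd_imp_pd: "has_pd i f D x \<Longrightarrow> pd i f x = D"
  unfolding has_pd_def pd_def by (rule DERIV_imp_deriv)

lemma has_pd_const: "has_pd i (\<lambda>x. c) 0 x"
  unfolding has_pd_def by simp

lemma has_pd_add:
  "has_pd i f D x \<Longrightarrow> has_pd i g E x \<Longrightarrow> has_pd i (\<lambda>x. f x + g x) (D + E) x"
  unfolding has_pd_def by (rule DERIV_add)

lemma has_pd_mult:
  "has_pd i f D x \<Longrightarrow> has_pd i g E x \<Longrightarrow> has_pd i (\<lambda>x. f x * g x) (D * g x + f x * E) x"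
  unfolding has_pd_def by (drule (1) DERIV_mult) (simp add: mult.commute)

lemma has_pd_sum:
  "(\<And>k. k \<in> I \<Longrightarrow> has_pd i (f k) (D k) x) \<Longrightarrow> has_pd i (\<lambda>x. \<Sum>k\<in>I. f k x) (\<Sum>k\<in>I. D k) x"
  unfolding has_pd_def by (rule DERIV_sum)

lemma eventually_line_in_open:
  fixes x :: "real^'n::finite"
  assumes "open K" "x \<in> K"
  shows "eventually (\<lambda>t. x + t *\<^sub>R v \<in> K) (nhds 0)"
proof -
  have "open ((\<lambda>t. x + t *\<^sub>R v) -` K)"
    by (intro open_vimage assms continuous_intros)
  then show ?thesis
    using eventually_nhds_in_open[of "(\<lambda>t. x + t *\<^sub>R v) -` K" 0] assms by simp
qed

lemma has_pd_cong:
  assumes "open K" "x \<in> K" "\<And>y. y \<in> K \<Longrightarrow> f y = g y"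
  shows "has_pd i f D x \<longleftrightarrow> has_pd i g D x"
proof -
  have "eventually (\<lambda>t. f (x + t *\<^sub>R axis i 1) = g (x + t *\<^sub>R axis i 1)) (nhds 0)"
    using eventually_line_in_open[OF assms(1,2), of "axis i 1"] by eventually_elim (rule assms)
  then show ?thesis
    unfolding has_pd_def by (intro DERIV_cong_ev) auto
qed

text \<open>\<open>deriv\<close> is a choice among the derivatives, and both functions have the same
  ones near \<open>x\<close>; hence the equality holds even where no derivative exists.\<close>

lemma pd_cong:
  assumes "open K" "x \<in> K" "\<And>y. y \<in> K \<Longrightarrow> f y = g y"
  shows "pd i f x = pd i g x"
proof -
  have "has_pd i f D x \<longleftrightarrow> has_pd i g D x" for D
    using has_pd_cong[OF assms] .
  then show ?thesis
    unfolding has_pd_def pd_def deriv_def by simp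
qed

lemma pdl_cong:
  assumes "open K" "x \<in> K" "\<And>y. y \<in> K \<Longrightarrow> f y = g y"
  shows "pdl is f x = pdl is g x"
  using assms(2)
proof (induction "is" arbitrary: x)
  case Nil
  then show ?case using assms(3) by simp
next
  case (Cons i "is")
  then show ?case using pd_cong[OF assms(1) Cons.prems Cons.IH] by simp
qed

lemma pdl_append: "pdl (is @ js) f = pdl is (pdl js f)"
  by (induction "is") auto

lemma smooth_on_continuous: "smooth_on K f \<Longrightarrow> continuous_on K f"
  unfolding smooth_on_def by (metis pdl.simps(1))

lemma smooth_on_has_pd: "smooth_on K f \<Longrightarrow> x \<in> K \<Longrightarrow> has_pd i f (pd i f x) x"
  unfolding smooth_on_def has_pd_def pd_def DERIV_deriv_iff_real_differentiable
  by (metis pdl.simps(1))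

lemma smooth_on_pd: "smooth_on K f \<Longrightarrow> smooth_on K (pd i f)"
proof -
  have "pdl is (pd i f) = pdl (is @ [i]) f" for "is"
    by (simp add: pdl_append)
  then show "smooth_on K f \<Longrightarrow> smooth_on K (pd i f)"
    unfolding smooth_on_def by simp
qed

lemma smooth_on_pdl: "smooth_on K f \<Longrightarrow> smooth_on K (pdl is f)"
  by (induction "is") (auto intro: smooth_on_pd)

lemma smooth_on_subset: "smooth_on K f \<Longrightarrow> H \<subseteq> K \<Longrightarrow> smooth_on H f"
  unfolding smooth_on_def by (meson continuous_on_subset subsetD)

text \<open>Every iterated partial derivative of \<open>f\<close> agrees on \<open>K\<close> with
  some member of \<open>X\<close>. Openness of \<open>K\<close> carries an agreement on
  \<open>K\<close> over to the next derivative. Inside \<open>step\<close> nothing is claimed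
  outside \<open>K\<close>, where \<open>pdl\<close> may behave arbitrarily.\<close>

lemma smooth_on_coinduct:
  assumes K: "open K" and "X f"
    and cont: "\<And>f. X f \<Longrightarrow> continuous_on K f"
    and step: "\<And>f i. X f \<Longrightarrow> \<exists>g. X g \<and> (\<forall>x\<in>K. has_pd i f (g x) x)"
  shows "smooth_on K f"
proof -
  have *: "\<exists>g. X g \<and> (\<forall>x\<in>K. pdl is f x = g x)" for "is"
  proof (induction "is")
    case Nil
    then show ?case using \<open>X f\<close> by auto
  next
    case (Cons i "is")
    then obtain g where g: "X g" "\<And>x. x \<in> K \<Longrightarrow> pdl is f x = g x" by blast
    obtain h where h: "X h" "\<And>x. x \<in> K \<Longrightarrow> has_pd i g (h x) x"
      using step[OF g(1)] by blast
    have "pdl (i # is) f x = h x" if "x \<in> K" for x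
      using pd_cong[OF K that g(2)] has_pd_imp_pd[OF h(2)[OF that]] by simp
    then show ?case using h(1) by blast
  qed
  show ?thesis
    unfolding smooth_on_def
  proof (intro allI conjI ballI)
    fix "is"
    obtain g where g: "X g" "\<And>x. x \<in> K \<Longrightarrow> pdl is f x = g x" using * by blast
    show "continuous_on K (pdl is f)"
      using cont[OF g(1)] g(2) by (subst continuous_on_cong[OF refl g(2)])
    fix i x assume x: "x \<in> K"
    obtain h where h: "\<And>x. x \<in> K \<Longrightarrow> has_pd i g (h x) x"
      using step[OF g(1)] by blast
    have "has_pd i (pdl is f) (h x) x"
      using h[OF x] has_pd_cong[OF K x, of "pdl is f" g] g(2) by blast
    then show "(\<lambda>t. pdl is f (x + t *\<^sub>R axis i 1)) differentiable (at 0)"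
      unfolding has_pd_def using real_differentiable_def by blast
  qed
qed

lemma smooth_fin_D:
  assumes "smooth_fin V Z"
  shows "finite V" "(\<forall>k\<in>V. v k = v' k) \<Longrightarrow> Z v = Z v'" "continuous_on UNIV Z"
    "k \<in> V \<Longrightarrow> ((\<lambda>t. Z (v(k := t))) has_real_derivative vpd k Z v) (at (v k))"
proof -
  show "finite V" "(\<forall>k\<in>V. v k = v' k) \<Longrightarrow> Z v = Z v'"
    using assms unfolding smooth_fin_def by blast+
  have *: "set ks \<subseteq> V \<Longrightarrow> continuous_on UNIV (vpdl ks Z) \<and>
        (\<forall>k\<in>V. \<forall>v. (\<lambda>t. vpdl ks Z (v(k := v k + t))) differentiable (at 0))" for ks
    using assms unfolding smooth_fin_def by blast
  show "continuous_on UNIV Z" using *[of "[]"] by simp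
  assume "k \<in> V"
  then have "(\<lambda>t. Z (v(k := v k + t))) differentiable (at 0)"
    using *[of "[]"] by simp
  then have "((\<lambda>t. Z (v(k := v k + t))) has_real_derivative vpd k Z v) (at 0)"
    unfolding vpd_def by (simp add: DERIV_deriv_iff_real_differentiable)
  then show "((\<lambda>t. Z (v(k := t))) has_real_derivative vpd k Z v) (at (v k))"
    using DERIV_shift[of "\<lambda>t. Z (v(k := t))" "vpd k Z v" 0 "v k"] by (simp add: add.commute)
qed

lemma smooth_fin_vpd:
  assumes "smooth_fin V Z" "k \<in> V"
  shows "smooth_fin V (vpd k Z)"
proof -
  have app: "vpdl ks (vpd k Z) = vpdl (ks @ [k]) Z" for ks
    by (induction ks) auto
  have "vpd k Z v = vpd k Z v'" if "\<forall>k\<in>V. v k = v' k" for v v'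
  proof -
    have "Z (v(k := v k + t)) = Z (v'(k := v' k + t))" for t
      using assms that by (intro smooth_fin_D(2)[OF assms(1)]) auto
    then show ?thesis unfolding vpd_def by simp
  qed
  then show ?thesis
    using assms unfolding smooth_fin_def app by simp
qed

lemma has_pd_compose_smooth_fin:
  assumes Z: "smooth_fin V Z" and g: "\<And>k. k \<in> V \<Longrightarrow> has_pd i (g k) (D k) x"
  shows "has_pd i (\<lambda>x. Z (\<lambda>k. g k x)) (\<Sum>k\<in>V. vpd k Z (\<lambda>k. g k x) * D k) x"
proof -
  have "((\<lambda>t. Z (\<lambda>k. g k (x + t *\<^sub>R axis i 1))) has_derivative
      (\<lambda>h. \<Sum>k\<in>V. vpd k Z (\<lambda>k. g k (x + 0 *\<^sub>R axis i 1)) * (D k * h))) (at 0)"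
  proof (rule has_derivative_compose_partials[where N = UNIV and V = "\<lambda>k t. g k (x + t *\<^sub>R axis i 1)"])
    show "continuous_on UNIV (vpd k Z)" if "k \<in> V" for k
      using smooth_fin_D(3)[OF smooth_fin_vpd[OF Z that]] .
    show "((\<lambda>t. g k (x + t *\<^sub>R axis i 1)) has_derivative (\<lambda>h. D k * h)) (at 0)" if "k \<in> V" for k
      using g[OF that] unfolding has_pd_def has_field_derivative_def .
    show "((\<lambda>t. Z (v(k := t))) has_real_derivative vpd k Z v) (at (v k))" if "k \<in> V" for k v
      using smooth_fin_D(4)[OF Z that] .
    show "Z u = Z v" if "\<forall>k\<in>V. u k = v k" for u v
      using smooth_fin_D(2)[OF Z that] .
  qed (use smooth_fin_D(1)[OF Z] in auto)
  then show ?thesis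
    unfolding has_pd_def has_field_derivative_def
    by (elim back_subst[of "\<lambda>d. (_ has_derivative d) _"]) (simp add: fun_eq_iff sum_distrib_right mult.assoc)
qed

lemma has_pd_exp_inner: "has_pd i (\<lambda>x. exp (inner a x)) (a $ i * exp (inner a x)) x"
  unfolding has_pd_def
  by (auto intro!: derivative_eq_intros simp: inner_add_right inner_axis mult.commute)

text \<open>A class of functions closed under partial derivatives, so that coinduction proves all its
  members smooth at once.\<close>
inductive smooth_gen :: "(real^'n::finite) set \<Rightarrow> (real^'n \<Rightarrow> real) \<Rightarrow> bool" for K where
  base: "smooth_on K f \<Longrightarrow> smooth_gen K f"
| const: "smooth_gen K (\<lambda>x. c)"
| add: "smooth_gen K f \<Longrightarrow> smooth_gen K g \<Longrightarrow> smooth_gen K (\<lambda>x. f x + g x)"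
| mult: "smooth_gen K f \<Longrightarrow> smooth_gen K g \<Longrightarrow> smooth_gen K (\<lambda>x. f x * g x)"
| exp_inner: "smooth_gen K (\<lambda>x. exp (inner a x))"
| comp: "smooth_fin V Z \<Longrightarrow> (\<And>k. k \<in> V \<Longrightarrow> smooth_on K (g k)) \<Longrightarrow> smooth_gen K (\<lambda>x. Z (\<lambda>k. g k x))"

lemma smooth_gen_sum:
  "(\<And>k. k \<in> I \<Longrightarrow> smooth_gen K (f k)) \<Longrightarrow> smooth_gen K (\<lambda>x. \<Sum>k\<in>I. f k x)"
proof (induction I rule: infinite_finite_induct)
  case (insert a I)
  then show ?case using smooth_gen.add[of K "f a" "\<lambda>x. \<Sum>k\<in>I. f k x"] by simp
qed (auto intro: smooth_gen.const)

lemma smooth_gen_continuous: "smooth_gen K f \<Longrightarrow> continuous_on K f"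
proof (induction rule: smooth_gen.induct)
  case (comp V Z g)
  \<comment> \<open>Nothing is known about \<open>g k\<close> for \<open>k\<close> outside
    \<open>V\<close>. The value 0 there makes every coordinate continuous, and \<open>Z\<close> does
    not see the change.\<close>
  have "continuous_on K (\<lambda>x k. if k \<in> V then g k x else 0)"
  proof (rule continuous_on_coordinatewise_then_product)
    show "continuous_on K (\<lambda>x. if k \<in> V then g k x else 0)" for k
      using smooth_on_continuous[OF comp.hyps(2)] by (cases "k \<in> V") auto
  qed
  then have "continuous_on K (\<lambda>x. Z (\<lambda>k. if k \<in> V then g k x else 0))"
    by (rule continuous_on_compose2[OF smooth_fin_D(3)[OF comp(1)]]) auto
  moreover have "Z (\<lambda>k. if k \<in> V then g k x else 0) = Z (\<lambda>k. g k x)" for x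
    by (rule smooth_fin_D(2)[OF comp(1)]) auto
  ultimately show ?case by simp
next
  case (exp_inner a)
  show ?case by (intro continuous_intros)
qed (auto intro: continuous_intros smooth_on_continuous)

lemma smooth_gen_has_pd: "smooth_gen K f \<Longrightarrow> \<exists>g. smooth_gen K g \<and> (\<forall>x\<in>K. has_pd i f (g x) x)"
proof (induction rule: smooth_gen.induct)
  case (base f)
  then show ?case
    using smooth_on_pd smooth_on_has_pd smooth_gen.base by blast
next
  case (const c)
  show ?case by (rule exI[of _ "\<lambda>x. 0"]) (auto intro: smooth_gen.const has_pd_const)
next
  case (add f g)
  then obtain f' g' where "smooth_gen K f'" "smooth_gen K g'"
    "\<forall>x\<in>K. has_pd i f (f' x) x" "\<forall>x\<in>K. has_pd i g (g' x) x" by blast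
  then show ?case
    by (intro exI[of _ "\<lambda>x. f' x + g' x"]) (auto intro: smooth_gen.add has_pd_add)
next
  case (mult f g)
  then obtain f' g' where "smooth_gen K f'" "smooth_gen K g'"
    "\<forall>x\<in>K. has_pd i f (f' x) x" "\<forall>x\<in>K. has_pd i g (g' x) x" by blast
  then show ?case using mult.hyps
    by (intro exI[of _ "\<lambda>x. f' x * g x + f x * g' x"])
      (auto intro!: smooth_gen.add smooth_gen.mult has_pd_mult)
next
  case (exp_inner a)
  show ?case
    by (rule exI[of _ "\<lambda>x. a $ i * exp (inner a x)"])
      (auto intro: smooth_gen.mult smooth_gen.const smooth_gen.exp_inner has_pd_exp_inner)
next
  case (comp V Z g)
  \<comment> \<open>The chain rule does not leave the class: \<open>vpd k Z\<close> is again a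
    smooth function of the variables in \<open>V\<close>.\<close>
  have "smooth_gen K (\<lambda>x. \<Sum>k\<in>V. vpd k Z (\<lambda>k. g k x) * pd i (g k) x)"
    by (intro smooth_gen_sum smooth_gen.mult smooth_gen.comp[OF smooth_fin_vpd[OF comp(1)]]
        smooth_gen.base smooth_on_pd comp(2))
  moreover have "has_pd i (\<lambda>x. Z (\<lambda>k. g k x)) (\<Sum>k\<in>V. vpd k Z (\<lambda>k. g k x) * pd i (g k) x) x"
    if "x \<in> K" for x
    by (intro has_pd_compose_smooth_fin[OF comp(1)] smooth_on_has_pd[OF comp(2)] that)
  ultimately show ?case by (intro exI conjI ballI)
qed

lemma smooth_on_gen: "open K \<Longrightarrow> smooth_gen K f \<Longrightarrow> smooth_on K f"
  using smooth_on_coinduct[of K "smooth_gen K" f] smooth_gen_continuous smooth_gen_has_pd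
  by metis

lemma smooth_on_const: "open K \<Longrightarrow> smooth_on K (\<lambda>x. c)"
  by (rule smooth_on_gen, assumption, rule smooth_gen.const)

lemma smooth_on_add: "open K \<Longrightarrow> smooth_on K f \<Longrightarrow> smooth_on K g \<Longrightarrow> smooth_on K (\<lambda>x. f x + g x)"
  by (rule smooth_on_gen, assumption, rule smooth_gen.add) (auto intro: smooth_gen.base)

lemma smooth_on_mult: "open K \<Longrightarrow> smooth_on K f \<Longrightarrow> smooth_on K g \<Longrightarrow> smooth_on K (\<lambda>x. f x * g x)"
  by (rule smooth_on_gen, assumption, rule smooth_gen.mult) (auto intro: smooth_gen.base)

lemma smooth_on_sum:
  "open K \<Longrightarrow> (\<And>k. k \<in> I \<Longrightarrow> smooth_on K (f k)) \<Longrightarrow> smooth_on K (\<lambda>x. \<Sum>k\<in>I. f k x)"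
  by (rule smooth_on_gen, assumption, rule smooth_gen_sum) (auto intro: smooth_gen.base)

lemma smooth_on_exp_inner: "open K \<Longrightarrow> smooth_on K (\<lambda>x. exp (inner a x))"
  by (rule smooth_on_gen, assumption, rule smooth_gen.exp_inner)

lemma smooth_on_compose_smooth_fin:
  "open K \<Longrightarrow> smooth_fin V Z \<Longrightarrow> (\<And>k. k \<in> V \<Longrightarrow> smooth_on K (g k)) \<Longrightarrow>
    smooth_on K (\<lambda>x. Z (\<lambda>k. g k x))"
  by (rule smooth_on_gen, assumption, rule smooth_gen.comp)

text \<open>Smoothness is defined by directional limits along the axes only. Frechet
  differentiability follows from the continuity of the partial derivatives, by the chain rule above
  applied to the coordinate functions of \<open>real^'n\<close>.\<close>

lemma smooth_on_has_derivative:
  fixes f :: "real^'n::finite \<Rightarrow> real"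
  assumes K: "open K" "smooth_on K f" "x \<in> K"
  shows "(f has_derivative (\<lambda>h. \<Sum>i\<in>UNIV. pd i f x * h $ i)) (at x)"
proof -
  define L :: "('n \<Rightarrow> real) \<Rightarrow> real^'n" where "L v = (\<chi> i. v i)" for v
  have contL: "continuous_on UNIV L"
    unfolding L_def
    by (intro continuous_on_vec_lambda) (simp add: continuous_on_product_coordinates)
  have "((\<lambda>z. (f \<circ> L) (\<lambda>i. z $ i)) has_derivative
      (\<lambda>h. \<Sum>i\<in>UNIV. (\<lambda>v. pd i f (L v)) (\<lambda>i. x $ i) * h $ i)) (at x)"
  proof (rule has_derivative_compose_partials[where N = "L -` K" and V = "\<lambda>i z. vec_nth z i"])
    show "open (L -` K)" using contL K(1) by (simp add: open_vimage)
    show "(\<lambda>i. x $ i) \<in> L -` K" using K(3) by (simp add: L_def)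
    show "continuous_on (L -` K) (\<lambda>v. pd i f (L v))" for i
      by (rule continuous_on_compose2[OF smooth_on_continuous[OF smooth_on_pd[OF K(2)]]
            continuous_on_subset[OF contL]]) auto
    show "((\<lambda>z. z $ i) has_derivative (\<lambda>h. h $ i)) (at x)" for i
      by (rule bounded_linear_imp_has_derivative) (rule bounded_linear_vec_nth)
    fix i v assume "v \<in> L -` K"
    then have "has_pd i f (pd i f (L v)) (L v)"
      using smooth_on_has_pd[OF K(2)] by blast
    moreover have "L v + t *\<^sub>R axis i 1 = L (v(i := v i + t))" for t
      by (simp add: L_def Finite_Cartesian_Product.vec_eq_iff axis_def)
    ultimately show "((\<lambda>t. (f \<circ> L) (v(i := t))) has_real_derivative pd i f (L v)) (at (v i))"
      unfolding has_pd_def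
      using DERIV_shift[of "\<lambda>t. (f \<circ> L) (v(i := t))" "pd i f (L v)" 0 "v i"] by (simp add: add.commute)
  qed auto
  then show ?thesis by (simp add: L_def o_def)
qed

section \<open>Operators applied to exponentials\<close>

text \<open>The leading coefficient \<open>l\<close> is prescribed on \<open>H\<close> and may vanish: \<open>d\<close> only bounds the degree in \<open>t\<close>.\<close>
definition expands ::
  "(real^'n::finite) set \<Rightarrow> real^'n \<Rightarrow> nat \<Rightarrow> (real^'n \<Rightarrow> real) \<Rightarrow> (real \<Rightarrow> real^'n \<Rightarrow> real) \<Rightarrow> bool" where
  "expands H p d l f \<longleftrightarrow> (\<exists>a. (\<forall>k. smooth_on H (a k)) \<and> (\<forall>x\<in>H. a d x = l x) \<and>
     (\<forall>t. \<forall>x\<in>H. f t x = exp (inner (t *\<^sub>R p) x) * (\<Sum>k\<le>d. t ^ k * a k x)))"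

lemma expands_cong:
  assumes "expands H p d l f" "\<And>x. x \<in> H \<Longrightarrow> l x = l' x" "\<And>t x. x \<in> H \<Longrightarrow> f t x = f' t x"
  shows "expands H p d l' f'"
  using assms unfolding expands_def by (elim exE) (rule exI, auto)

lemma expands_exp: "open H \<Longrightarrow> expands H p 0 (\<lambda>x. 1) (\<lambda>t x. exp (inner (t *\<^sub>R p) x))"
  unfolding expands_def by (rule exI[of _ "\<lambda>k x. 1"]) (auto intro: smooth_on_const)

lemma expands_0: "open H \<Longrightarrow> expands H p d (\<lambda>x. 0) (\<lambda>t x. 0)"
  unfolding expands_def by (rule exI[of _ "\<lambda>k x. 0"]) (auto intro: smooth_on_const)

lemma expands_mult:
  assumes "open H" "smooth_on H A" "expands H p d l f"
  shows "expands H p d (\<lambda>x. A x * l x) (\<lambda>t x. A x * f t x)"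
proof -
  obtain a where a: "\<And>k. smooth_on H (a k)" "\<And>x. x \<in> H \<Longrightarrow> a d x = l x"
    "\<And>t x. x \<in> H \<Longrightarrow> f t x = exp (inner (t *\<^sub>R p) x) * (\<Sum>k\<le>d. t ^ k * a k x)"
    using assms(3) unfolding expands_def by blast
  show ?thesis
    unfolding expands_def
    by (rule exI[of _ "\<lambda>k x. A x * a k x"])
      (auto simp: a(2,3) sum_distrib_left mult_ac intro!: smooth_on_mult assms a(1))
qed

lemma expands_add:
  assumes "open H" "expands H p d l f" "expands H p d m g"
  shows "expands H p d (\<lambda>x. l x + m x) (\<lambda>t x. f t x + g t x)"
proof -
  obtain a where a: "\<And>k. smooth_on H (a k)" "\<And>x. x \<in> H \<Longrightarrow> a d x = l x"
    "\<And>t x. x \<in> H \<Longrightarrow> f t x = exp (inner (t *\<^sub>R p) x) * (\<Sum>k\<le>d. t ^ k * a k x)"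
    using assms(2) unfolding expands_def by blast
  obtain b where b: "\<And>k. smooth_on H (b k)" "\<And>x. x \<in> H \<Longrightarrow> b d x = m x"
    "\<And>t x. x \<in> H \<Longrightarrow> g t x = exp (inner (t *\<^sub>R p) x) * (\<Sum>k\<le>d. t ^ k * b k x)"
    using assms(3) unfolding expands_def by blast
  show ?thesis
    unfolding expands_def
    by (rule exI[of _ "\<lambda>k x. a k x + b k x"])
      (auto simp: a(2,3) b(2,3) sum.distrib distrib_left intro!: smooth_on_add assms a(1) b(1))
qed

lemma expands_sum:
  assumes "open H" "\<And>i. i \<in> I \<Longrightarrow> expands H p d (l i) (f i)"
  shows "expands H p d (\<lambda>x. \<Sum>i\<in>I. l i x) (\<lambda>t x. \<Sum>i\<in>I. f i t x)"
  using assms(2)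
proof (induction I rule: infinite_finite_induct)
  case (insert i I)
  then have "expands H p d (\<lambda>x. l i x + (\<Sum>i\<in>I. l i x)) (\<lambda>t x. f i t x + (\<Sum>i\<in>I. f i t x))"
    by (intro expands_add assms(1)) auto
  then show ?case using insert.hyps by simp
qed (auto intro: expands_0 assms(1))

text \<open>Brings contributions of lower degree to a common degree bound, where they add 0 to the
  leading coefficient.\<close>

lemma expands_raise:
  assumes "open H" "expands H p d l f" "d < d'"
  shows "expands H p d' (\<lambda>x. 0) f"
proof -
  obtain a where a: "\<And>k. smooth_on H (a k)"
    "\<And>t x. x \<in> H \<Longrightarrow> f t x = exp (inner (t *\<^sub>R p) x) * (\<Sum>k\<le>d. t ^ k * a k x)"
    using assms(2) unfolding expands_def by blast
  define b where "b k x = (if k \<le> d then a k x else 0)" for k x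
  have "smooth_on H (b k)" for k
    using a(1)[of k] smooth_on_const[OF assms(1), of 0] unfolding b_def[abs_def] by (cases "k \<le> d") auto
  moreover have "(\<Sum>k\<le>d'. t ^ k * b k x) = (\<Sum>k\<le>d. t ^ k * a k x)" for t x
    using assms(3) unfolding b_def by (intro sum.mono_neutral_cong_right) auto
  ultimately show ?thesis
    unfolding expands_def using assms(3)
    by (intro exI[of _ b]) (auto simp: a(2) b_def)
qed

text \<open>Differentiating the exponential brings down \<open>t * p $ i\<close>, which raises the
  degree by one. Differentiating the coefficients keeps the power of \<open>t\<close> and so cannot
  reach the new top power.\<close>

lemma expands_pd:
  assumes "open H" "expands H p d l f"
  shows "expands H p (Suc d) (\<lambda>x. p $ i * l x) (\<lambda>t. pd i (f t))"
proof -
  obtain a where a: "\<And>k. smooth_on H (a k)" "\<And>x. x \<in> H \<Longrightarrow> a d x = l x"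
    "\<And>t x. x \<in> H \<Longrightarrow> f t x = exp (inner (t *\<^sub>R p) x) * (\<Sum>k\<le>d. t ^ k * a k x)"
    using assms(2) unfolding expands_def by blast
  \<comment> \<open>The first summand is the old coefficient shifted up by one power. The guard
    \<open>k \<le> d\<close> leaves it alone at \<open>k = Suc d\<close>, which is exactly the new
    leading coefficient.\<close>
  define b where "b k x = (if k = 0 then 0 else p $ i * a (k - 1) x) + (if k \<le> d then pd i (a k) x else 0)" for k x
  have smb: "smooth_on H (b k)" for k
    unfolding b_def[abs_def]
    by (intro smooth_on_add assms(1))
      (cases "k = 0"; cases "k \<le> d"; auto intro!: smooth_on_mult smooth_on_const smooth_on_pd a(1) assms(1))+
  have "pd i (f t) x = exp (inner (t *\<^sub>R p) x) * (\<Sum>k\<le>Suc d. t ^ k * b k x)" if x: "x \<in> H" for t x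
  proof -
    have hpa: "has_pd i (\<lambda>x. t ^ k * a k x) (t ^ k * pd i (a k) x) x" for k
      using has_pd_mult[OF has_pd_const smooth_on_has_pd[OF a(1) x, of i k], of "t ^ k"] by simp
    have "pd i (f t) x = pd i (\<lambda>x. exp (inner (t *\<^sub>R p) x) * (\<Sum>k\<le>d. t ^ k * a k x)) x"
      by (rule pd_cong[OF assms(1) x]) (rule a(3))
    also have "\<dots> = ((t *\<^sub>R p) $ i * exp (inner (t *\<^sub>R p) x)) * (\<Sum>k\<le>d. t ^ k * a k x) +
        exp (inner (t *\<^sub>R p) x) * (\<Sum>k\<le>d. t ^ k * pd i (a k) x)"
      by (rule has_pd_imp_pd) (intro has_pd_mult has_pd_exp_inner has_pd_sum hpa)
    also have "\<dots> = exp (inner (t *\<^sub>R p) x) *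
        ((\<Sum>k\<le>d. t ^ Suc k * (p $ i * a k x)) + (\<Sum>k\<le>d. t ^ k * pd i (a k) x))"
      by (simp add: algebra_simps sum_distrib_left)
    also have "(\<Sum>k\<le>d. t ^ Suc k * (p $ i * a k x)) =
        (\<Sum>k\<le>Suc d. t ^ k * (if k = 0 then 0 else p $ i * a (k - 1) x))"
      by (subst sum.atMost_Suc_shift) simp
    also have "(\<Sum>k\<le>d. t ^ k * pd i (a k) x) =
        (\<Sum>k\<le>Suc d. t ^ k * (if k \<le> d then pd i (a k) x else 0))"
      by simp
    finally show ?thesis
      by (simp only: b_def distrib_left sum.distrib)
  qed
  then show ?thesis
    unfolding expands_def using smb a(2) by (intro exI[of _ b]) (auto simp: b_def)
qed

lemma expands_pdl:
  assumes "open H" "expands H p d l f"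
  shows "expands H p (d + length is) (\<lambda>x. (\<Prod>i\<leftarrow>is. p $ i) * l x) (\<lambda>t. pdl is (f t))"
proof (induction "is")
  case Nil
  then show ?case using assms(2) by simp
next
  case (Cons i "is")
  from expands_pd[OF assms(1) Cons, of i] show ?case by (simp add: mult_ac)
qed

text \<open>The exponential never vanishes, and a polynomial in \<open>t\<close> that is zero for
  every real \<open>t\<close> has only zero coefficients.\<close>

lemma expands_imp_lead_eq_0:
  assumes "expands H p d l f" "x \<in> H" "\<And>t. f t x = 0"
  shows "l x = 0"
proof -
  obtain a where a: "a d x = l x"
    "\<And>t. f t x = exp (inner (t *\<^sub>R p) x) * (\<Sum>k\<le>d. t ^ k * a k x)"
    using assms(1,2) unfolding expands_def by blast
  have "\<forall>t. (\<Sum>k\<le>d. a k x * t ^ k) = 0"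
    using a(2) assms(3) by (simp add: mult.commute)
  then have "a d x = 0" using polyfun_eq_0[of "\<lambda>k. a k x" d] by blast
  then show ?thesis using a(1) by simp
qed

lemma ex_list_count: "\<exists>xs. \<forall>i. count_list xs i = \<alpha> (i :: 'n::finite)"
proof -
  obtain M :: "'n multiset" where M: "\<And>i. count M i = \<alpha> i"
    by (metis count_Abs_multiset finite)
  obtain xs where "mset xs = M" using ex_mset by blast
  then show ?thesis using M by (metis count_mset count_list_eq_length_filter)
qed

lemma expands_pdiff:
  fixes H :: "(real^'n::finite) set"
  assumes "open H" "expands H p d l f"
  shows "expands H p (d + mi_abs \<alpha>) (\<lambda>x. (\<Prod>i\<in>UNIV. (p $ i) ^ \<alpha> i) * l x) (\<lambda>t. pdiff \<alpha> (f t))"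
proof -
  \<comment> \<open>Whichever enumeration is chosen, the degree and the leading coefficient depend
    only on how often each index occurs in it.\<close>
  define xs where "xs = (SOME xs. \<forall>i. count_list xs i = \<alpha> i)"
  have xs: "count_list xs i = \<alpha> i" for i
    unfolding xs_def using someI_ex[OF ex_list_count[of \<alpha>]] by blast
  have "length xs = sum (count_list xs) UNIV"
    using sum_count_set[of xs UNIV] by simp
  then have len: "length xs = mi_abs \<alpha>"
    by (simp add: mi_abs_def xs)
  have "(\<Prod>i\<leftarrow>xs. p $ i) = (\<Prod>i\<in>UNIV. (p $ i) ^ count_list xs i)"
  proof (induction xs)
    case (Cons a xs)
    have "(\<Prod>i\<in>UNIV. (p $ i) ^ count_list (a # xs) i) =
        (\<Prod>i\<in>UNIV. (if i = a then p $ i else 1) * (p $ i) ^ count_list xs i)"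
      by (intro prod.cong) auto
    then show ?case using Cons by (simp add: prod.distrib)
  qed simp
  then have "(\<Prod>i\<leftarrow>xs. p $ i) = (\<Prod>i\<in>UNIV. (p $ i) ^ \<alpha> i)" by (simp add: xs)
  with expands_pdl[OF assms, of xs] show ?thesis
    by (simp add: pdiff_def xs_def[symmetric] len)
qed

text \<open>Terms with \<open>mi_abs \<alpha>\<close> below the order are raised and lose their
  leading coefficient; the remaining ones add up to the main symbol. Thus applying an operator
  multiplies leading coefficients by \<open>MF\<close>, and compositions become commutative
  products.\<close>

lemma expands_op_apply:
  fixes H :: "(real^'n::finite) set"
  assumes "open H" "H \<subseteq> K" "op_class K A" "expands H p d l f"
  shows "expands H p (ord K A + d) (\<lambda>x. MF K A x p * l x) (\<lambda>t. op_apply K A (f t))"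
proof -
  have fin: "finite (supp K A)" and sm: "smooth_on H (A \<alpha>)" for \<alpha>
    using assms(2,3) smooth_on_subset unfolding op_class_def by blast+
  define L where "L \<alpha> x = (if mi_abs \<alpha> = ord K A then A \<alpha> x * ((\<Prod>i\<in>UNIV. (p $ i) ^ \<alpha> i) * l x) else 0)" for \<alpha> x
  have "expands H p (ord K A + d) (L \<alpha>) (\<lambda>t x. A \<alpha> x * pdiff \<alpha> (f t) x)" if "\<alpha> \<in> supp K A" for \<alpha>
  proof -
    have E: "expands H p (d + mi_abs \<alpha>) (\<lambda>x. A \<alpha> x * ((\<Prod>i\<in>UNIV. (p $ i) ^ \<alpha> i) * l x)) (\<lambda>t x. A \<alpha> x * pdiff \<alpha> (f t) x)"
      by (rule expands_mult[OF assms(1) sm expands_pdiff[OF assms(1,4)]])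
    have "mi_abs \<alpha> \<le> ord K A"
      using that fin unfolding ord_def by auto
    then show ?thesis
      using E expands_raise[OF assms(1) E, of "ord K A + d"]
      unfolding L_def[abs_def] by (cases "mi_abs \<alpha> = ord K A") (auto simp: add.commute)
  qed
  then have "expands H p (ord K A + d) (\<lambda>x. \<Sum>\<alpha>\<in>supp K A. L \<alpha> x) (\<lambda>t x. \<Sum>\<alpha>\<in>supp K A. A \<alpha> x * pdiff \<alpha> (f t) x)"
    by (rule expands_sum[OF assms(1)])
  moreover have "(\<Sum>\<alpha>\<in>supp K A. L \<alpha> x) = MF K A x p * l x" for x
    unfolding L_def MF_def sum_distrib_right
    by (simp add: sum.inter_filter[OF fin] mult.assoc)
  ultimately show ?thesis
    by (simp add: op_apply_def[abs_def])
qed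

text \<open>At order 0 only the zero multi-index can contribute, so the main symbol does not depend
  on \<open>p\<close> and is the function by which the operator multiplies. This matches the
  arguments of the \<open>Z\<close> in the evaluation with those in the abelianization.\<close>

lemma MF_eq_gvals:
  assumes "op_class K (ops k)" "ord K (ops k) = 0" "x \<in> K"
  shows "MF K (ops k) x p = gvals ops x k"
proof -
  have *: "{\<alpha> \<in> supp K (ops k). mi_abs \<alpha> = 0} = {\<alpha> \<in> supp K (ops k). \<alpha> = (\<lambda>_. 0)}"
    by (auto simp: mi_abs_def)
  show ?thesis
  proof (cases "(\<lambda>_. 0) \<in> supp K (ops k)")
    case True
    then have "{\<alpha> \<in> supp K (ops k). mi_abs \<alpha> = 0} = {\<lambda>_. 0}" using * by auto
    then show ?thesis using assms(2) by (simp add: MF_def gvals_def)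
  next
    \<comment> \<open>The function by which the operator multiplies is then 0 on \<open>K\<close>:
      both sides vanish.\<close>
    case False
    then have "{\<alpha> \<in> supp K (ops k). mi_abs \<alpha> = 0} = {}" using * by auto
    then have "MF K (ops k) x p = 0" unfolding MF_def assms(2) by (metis (no_types, lifting) sum.empty)
    moreover have "gvals ops x k = 0" using False assms(3) by (auto simp: gvals_def supp_def)
    ultimately show ?thesis by simp
  qed
qed

lemma smooth_fin_gvals_eq_MF:
  assumes "H \<subseteq> K" "\<And>k. k < N \<Longrightarrow> op_class K (ops k)"
    and "smooth_fin {k. k < N \<and> ord K (ops k) = 0} Z" "x \<in> H"
  shows "Z (gvals ops x) = Z (\<lambda>k. MF K (ops k) x p)"
proof (rule smooth_fin_D(2)[OF assms(3)], safe)
  fix k assume "k < N" "ord K (ops k) = 0"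
  then show "gvals ops x k = MF K (ops k) x p"
    using MF_eq_gvals[of K ops k x p] assms by auto
qed

lemma smooth_on_gvals:
  assumes "open H" "H \<subseteq> K" "\<And>k. k < N \<Longrightarrow> op_class K (ops k)" "smooth_fin {k. k < N \<and> C k} Z"
  shows "smooth_on H (\<lambda>x. Z (gvals ops x))"
proof -
  have "smooth_on H (\<lambda>x. Z (\<lambda>k. (\<lambda>k x. gvals ops x k) k x))"
    by (rule smooth_on_compose_smooth_fin[OF assms(1,4)])
      (use assms(2,3) in \<open>auto simp: gvals_def[abs_def] op_class_def intro: smooth_on_subset\<close>)
  then show ?thesis by simp
qed

text \<open>The weight of the word is the sum of the orders, so each factor adds its order to the
  degree and its main symbol to the product. The leading coefficient is the abelianized monomial at
  the main symbols.\<close>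

lemma expands_mono_apply:
  fixes H :: "(real^'n::finite) set"
  assumes H: "open H" "H \<subseteq> K" and ops: "\<And>k. k < N \<Longrightarrow> op_class K (ops k)"
    and "length Zs = Suc (length bs)" "\<forall>k\<in>set bs. k < N"
    and "\<forall>Z\<in>set Zs. smooth_fin {k. k < N \<and> ord K (ops k) = 0} Z"
  shows "expands H p (wt (\<lambda>k. ord K (ops k)) bs)
      (\<lambda>x. (\<Prod>Z\<leftarrow>Zs. Z (\<lambda>k. MF K (ops k) x p)) * (\<Prod>k\<leftarrow>bs. MF K (ops k) x p))
      (\<lambda>t. mono_apply K ops bs Zs (\<lambda>x. exp (inner (t *\<^sub>R p) x)))"
  using assms(4-6)
proof (induction bs arbitrary: Zs)
  case Nil
  then obtain Z where Z: "Zs = [Z]" by (metis length_0_conv length_Suc_conv list.size(3))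
  have ZE: "Z (gvals ops x) = Z (\<lambda>k. MF K (ops k) x p)" if "x \<in> H" for x
    using Nil.prems Z by (intro smooth_fin_gvals_eq_MF[OF H(2) ops _ that]) auto
  have "smooth_on H (\<lambda>x. Z (gvals ops x))"
    using Nil.prems Z by (intro smooth_on_gvals[OF H ops]) auto
  from expands_mult[OF H(1) this expands_exp[OF H(1)], of p]
  have "expands H p (wt (\<lambda>k. ord K (ops k)) []) (\<lambda>x. Z (gvals ops x) * 1)
      (\<lambda>t x. Z (gvals ops x) * exp (inner (t *\<^sub>R p) x))" by (simp add: wt_def)
  then show ?case
    by (rule expands_cong) (auto simp: Z ZE)
next
  case (Cons b bs)
  then obtain Z Zs' where Z: "Zs = Z # Zs'" by (cases Zs) auto
  have ZE: "Z (gvals ops x) = Z (\<lambda>k. MF K (ops k) x p)" if "x \<in> H" for x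
    using Cons.prems Z by (intro smooth_fin_gvals_eq_MF[OF H(2) ops _ that]) auto
  have sm: "smooth_on H (\<lambda>x. Z (gvals ops x))"
    using Cons.prems Z by (intro smooth_on_gvals[OF H ops]) auto
  have IH: "expands H p (wt (\<lambda>k. ord K (ops k)) bs)
      (\<lambda>x. (\<Prod>Z\<leftarrow>Zs'. Z (\<lambda>k. MF K (ops k) x p)) * (\<Prod>k\<leftarrow>bs. MF K (ops k) x p))
      (\<lambda>t. mono_apply K ops bs Zs' (\<lambda>x. exp (inner (t *\<^sub>R p) x)))"
    using Cons.prems Z by (intro Cons.IH) auto
  have "op_class K (ops b)" using Cons.prems ops by simp
  from expands_mult[OF H(1) sm expands_op_apply[OF H this IH]]
  have "expands H p (wt (\<lambda>k. ord K (ops k)) (b # bs))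
      (\<lambda>x. Z (gvals ops x) * (MF K (ops b) x p * ((\<Prod>Z\<leftarrow>Zs'. Z (\<lambda>k. MF K (ops k) x p)) * (\<Prod>k\<leftarrow>bs. MF K (ops k) x p))))
      (\<lambda>t x. Z (gvals ops x) * op_apply K (ops b) (mono_apply K ops bs Zs' (\<lambda>x. exp (inner (t *\<^sub>R p) x))) x)"
    by (simp add: wt_def)
  then show ?case
    by (rule expands_cong) (auto simp: Z ZE)
qed

section \<open>Formally vanishing parts of a polynomial act as the zero operator\<close>

lemma pdl_sum_list:
  assumes "open H" "\<And>c f. (c, f) \<in> set L \<Longrightarrow> smooth_on H f" "x \<in> H"
  shows "pdl is (\<lambda>x. \<Sum>(c, f)\<leftarrow>L. c * f x) x = (\<Sum>(c, f)\<leftarrow>L. c * pdl is f x)"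
  using assms(3)
proof (induction "is" arbitrary: x)
  case (Cons i "is")
  have "has_pd i (\<lambda>x. \<Sum>(c, f)\<leftarrow>L. c * pdl is f x) (\<Sum>(c, f)\<leftarrow>L. c * pd i (pdl is f) x) x"
    using assms(2)
  proof (induction L)
    case (Cons q L)
    obtain c f where q: "q = (c, f)" by force
    have "has_pd i (\<lambda>x. c * pdl is f x) (c * pd i (pdl is f) x) x"
      using has_pd_mult[OF has_pd_const smooth_on_has_pd[OF smooth_on_pdl \<open>x \<in> H\<close>], of f i c] Cons.prems q by auto
    then show ?case
      using has_pd_add[OF _ Cons.IH] Cons.prems q by auto
  qed (simp add: has_pd_const)
  then have "pd i (\<lambda>x. \<Sum>(c, f)\<leftarrow>L. c * pdl is f x) x = (\<Sum>(c, f)\<leftarrow>L. c * pd i (pdl is f) x)"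
    by (rule has_pd_imp_pd)
  moreover have "pd i (pdl is (\<lambda>x. \<Sum>(c, f)\<leftarrow>L. c * f x)) x = pd i (\<lambda>x. \<Sum>(c, f)\<leftarrow>L. c * pdl is f x) x"
    by (rule pd_cong[OF assms(1) Cons.prems Cons.IH])
  ultimately show ?case by simp
qed simp

lemma op_apply_sum_list:
  assumes "open H" "\<And>c f. (c, f) \<in> set L \<Longrightarrow> smooth_on H f" "x \<in> H"
  shows "op_apply K A (\<lambda>x. \<Sum>(c, f)\<leftarrow>L. c * f x) x = (\<Sum>(c, f)\<leftarrow>L. c * op_apply K A f x)"
proof -
  have "op_apply K A (\<lambda>x. \<Sum>(c, f)\<leftarrow>L. c * f x) x =
      (\<Sum>\<alpha>\<in>supp K A. A \<alpha> x * (\<Sum>(c, f)\<leftarrow>L. c * pdiff \<alpha> f x))"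
    unfolding op_apply_def pdiff_def using pdl_sum_list[OF assms] by simp
  also have "\<dots> = (\<Sum>(c, f)\<leftarrow>L. c * op_apply K A f x)"
    unfolding op_apply_def
    by (induction L) (auto simp: algebra_simps sum.distrib sum_distrib_left)
  finally show ?thesis .
qed

lemma op_apply_cong:
  assumes "open H" "x \<in> H" "\<And>y. y \<in> H \<Longrightarrow> f y = g y"
  shows "op_apply K A f x = op_apply K A g x"
  unfolding op_apply_def pdiff_def using pdl_cong[OF assms] by simp

lemma smooth_on_op_apply:
  assumes "open H" "H \<subseteq> K" "op_class K A" "smooth_on H f"
  shows "smooth_on H (op_apply K A f)"
  unfolding op_apply_def[abs_def] pdiff_def
  by (intro smooth_on_sum smooth_on_mult smooth_on_pdl assms)
    (use assms in \<open>auto simp: op_class_def intro: smooth_on_subset\<close>)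

lemma smooth_on_mono_apply:
  assumes H: "open H" "H \<subseteq> K" and ops: "\<And>k. k < N \<Longrightarrow> op_class K (ops k)"
    and "length Zs = Suc (length bs)" "\<forall>k\<in>set bs. k < N"
    and "\<forall>Z\<in>set Zs. smooth_fin {k. k < N \<and> C k} Z" and \<psi>: "smooth_on H \<psi>"
  shows "smooth_on H (mono_apply K ops bs Zs \<psi>)"
  using assms(4-6)
proof (induction bs arbitrary: Zs)
  case Nil
  then obtain Z where Z: "Zs = [Z]" by (metis length_0_conv length_Suc_conv list.size(3))
  have "smooth_on H (\<lambda>x. Z (gvals ops x))"
    using Nil.prems Z by (intro smooth_on_gvals[OF H ops]) auto
  then show ?case
    using smooth_on_mult[OF H(1) _ \<psi>] by (simp add: Z fun_eq_iff[symmetric] mono_apply.simps(1)[abs_def])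
next
  case (Cons b bs)
  then obtain Z Zs' where Z: "Zs = Z # Zs'" by (cases Zs) auto
  have sm: "smooth_on H (\<lambda>x. Z (gvals ops x))"
    using Cons.prems Z by (intro smooth_on_gvals[OF H ops]) auto
  have IH: "smooth_on H (mono_apply K ops bs Zs' \<psi>)"
    using Cons.prems Z by (intro Cons.IH) auto
  have "op_class K (ops b)" using Cons.prems ops by simp
  from smooth_on_mult[OF H(1) sm smooth_on_op_apply[OF H this IH]]
  show ?case by (simp add: Z mono_apply.simps(2)[abs_def])
qed

text \<open>Freezing the first argument turns the leading coefficients into scalars; this makes the
  induction on the word go through.\<close>
lemma sum_mono_apply_eq_0:
  assumes H: "open H" "H \<subseteq> K" and ops: "\<And>k. k < N \<Longrightarrow> op_class K (ops k)"
    and \<psi>: "smooth_on H \<psi>" and "\<forall>k\<in>set bs. k < N"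
    and "\<And>c Zs. (c, Zs) \<in> set L \<Longrightarrow> length Zs = Suc (length bs)"
    and "\<And>c Zs Z. (c, Zs) \<in> set L \<Longrightarrow> Z \<in> set Zs \<Longrightarrow> smooth_fin {k. k < N \<and> C k} Z"
    and "\<And>g. (\<Sum>(c, Zs)\<leftarrow>L. c * (\<Prod>j<length Zs. (Zs ! j) (g j))) = 0"
    and "x \<in> H"
  shows "(\<Sum>(c, Zs)\<leftarrow>L. c * mono_apply K ops bs Zs \<psi> x) = 0"
  using assms(5-)
proof (induction bs arbitrary: L x)
  case Nil
  have "c * mono_apply K ops [] Zs \<psi> x = (c * (\<Prod>j<length Zs. (Zs ! j) (gvals ops x))) * \<psi> x"
    if "(c, Zs) \<in> set L" for c Zs
  proof -
    obtain Z where "Zs = [Z]"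
      using Nil.prems(2)[of c Zs] \<open>(c, Zs) \<in> set L\<close>
      by (metis length_0_conv length_Suc_conv list.size(3))
    then show ?thesis by simp
  qed
  then have "(\<Sum>(c, Zs)\<leftarrow>L. c * mono_apply K ops [] Zs \<psi> x) =
      (\<Sum>(c, Zs)\<leftarrow>L. (c * (\<Prod>j<length Zs. (Zs ! j) (gvals ops x))) * \<psi> x)"
    by (intro arg_cong[of _ _ sum_list] map_cong) auto
  also have "\<dots> = (\<Sum>(c, Zs)\<leftarrow>L. c * (\<Prod>j<length Zs. (Zs ! j) (gvals ops x))) * \<psi> x"
    by (simp add: sum_list_mult_const case_prod_unfold)
  also have "\<dots> = 0" using Nil.prems(4)[of "\<lambda>j. gvals ops x"] by simp
  finally show ?case .
next
  case (Cons b bs)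
  define L' where "L' = map (\<lambda>(c, Zs). (c * hd Zs (gvals ops x), tl Zs)) L"
  have split: "\<exists>Z Zs'. Zs = Z # Zs'" if "(c, Zs) \<in> set L" for c Zs
    using Cons.prems(2)[OF that] by (cases Zs) auto
  \<comment> \<open>The scalars in \<open>L'\<close> stay frozen at \<open>x\<close> while
    \<open>y\<close> runs over \<open>H\<close>: the inner sum must vanish as a function before the
    next operator can be applied to it.\<close>
  have z: "(\<Sum>(c, Zs)\<leftarrow>L'. c * mono_apply K ops bs Zs \<psi> y) = 0" if "y \<in> H" for y
  proof (rule Cons.IH)
    show "\<forall>k\<in>set bs. k < N" using Cons.prems(1) by simp
    show "length Zs = Suc (length bs)" if "(c, Zs) \<in> set L'" for c Zs
      using that Cons.prems(2) unfolding L'_def by fastforce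
    show "smooth_fin {k. k < N \<and> C k} Z" if L: "(c, Zs) \<in> set L'" and Z: "Z \<in> set Zs" for c Zs Z
    proof -
      obtain c0 Zs0 where "(c0, Zs0) \<in> set L" "Zs = tl Zs0"
        using L unfolding L'_def by auto
      then show ?thesis using Cons.prems(3) Z split by (metis list.sel(3) list.set_intros(2))
    qed
    show "(\<Sum>(c, Zs)\<leftarrow>L'. c * (\<Prod>j<length Zs. (Zs ! j) (g j))) = 0" for g
    proof -
      have eq: "c * hd Zs (gvals ops x) * (\<Prod>j<length (tl Zs). (tl Zs ! j) (g j)) =
        c * (\<Prod>j<length Zs. (Zs ! j) (case_nat (gvals ops x) g j))" if "(c, Zs) \<in> set L" for c Zs
        using split[OF that] by (auto simp: prod.lessThan_Suc_shift simp del: prod.lessThan_Suc)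
      have "(\<Sum>(c, Zs)\<leftarrow>L'. c * (\<Prod>j<length Zs. (Zs ! j) (g j))) =
        (\<Sum>(c, Zs)\<leftarrow>L. c * (\<Prod>j<length Zs. (Zs ! j) (case_nat (gvals ops x) g j)))"
        unfolding L'_def map_map
        by (intro arg_cong[of _ _ sum_list] map_cong refl) (auto simp only: comp_apply prod.case eq)
      then show ?thesis using Cons.prems(4) by simp
    qed
  qed (rule that)
  define M where "M = map (\<lambda>(c, Zs). (c, mono_apply K ops bs Zs \<psi>)) L'"
  have sm: "smooth_on H f" if cf: "(c, f) \<in> set M" for c f
  proof -
    obtain c0 Zs0 where *: "(c0, Zs0) \<in> set L" "f = mono_apply K ops bs (tl Zs0) \<psi>"
      using cf unfolding L'_def M_def by auto
    show ?thesis unfolding *(2)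
    proof (rule smooth_on_mono_apply[OF H ops])
      show "length (tl Zs0) = Suc (length bs)" using Cons.prems(2)[OF *(1)] by simp
      show "\<forall>Z\<in>set (tl Zs0). smooth_fin {k. k < N \<and> C k} Z"
        using Cons.prems(3)[OF *(1)] split[OF *(1)] by auto
    qed (use Cons.prems(1) \<psi> in auto)
  qed
  have "(\<Sum>(c, Zs)\<leftarrow>L. c * mono_apply K ops (b # bs) Zs \<psi> x) = (\<Sum>(c, f)\<leftarrow>M. c * op_apply K (ops b) f x)"
    unfolding M_def L'_def
    using split by (auto simp: case_prod_unfold comp_def intro!: arg_cong[of _ _ sum_list] map_cong) fastforce
  also have "\<dots> = op_apply K (ops b) (\<lambda>x. \<Sum>(c, f)\<leftarrow>M. c * f x) x"
    by (rule op_apply_sum_list[symmetric, OF H(1) sm Cons.prems(5)])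
  \<comment> \<open>The zero function is written as the empty combination, so that linearity itself
    yields that its image is 0.\<close>
  also have "\<dots> = op_apply K (ops b) (\<lambda>x. \<Sum>(c, f)\<leftarrow>[]. c * f x) x"
    by (rule op_apply_cong[OF H(1) Cons.prems(5)])
      (use z in \<open>simp add: M_def case_prod_unfold comp_def\<close>)
  also have "\<dots> = (\<Sum>(c, f)\<leftarrow>[]. c * op_apply K (ops b) f x)"
    by (rule op_apply_sum_list[OF H(1) _ Cons.prems(5)]) simp
  finally show ?case by simp
qed

section \<open>Differentiating the relations between main symbols\<close>

lemma sum_list_group_fst:
  fixes f :: "'a \<times> 'b \<Rightarrow> 'c::comm_monoid_add"
  assumes "finite B" "fst ` set S \<subseteq> B"
  shows "(\<Sum>m\<leftarrow>S. f m) = (\<Sum>\<beta>\<in>B. \<Sum>m\<leftarrow>filter (\<lambda>m. fst m = \<beta>) S. f m)"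
  using assms(2)
proof (induction S)
  case (Cons m S)
  have "(\<Sum>\<beta>\<in>B. \<Sum>m\<leftarrow>filter (\<lambda>m. fst m = \<beta>) (m # S). f m) =
      (\<Sum>\<beta>\<in>B. (if fst m = \<beta> then f m else 0) + (\<Sum>m\<leftarrow>filter (\<lambda>m. fst m = \<beta>) S. f m))"
    by (intro sum.cong) auto
  also have "\<dots> = f m + (\<Sum>\<beta>\<in>B. \<Sum>m\<leftarrow>filter (\<lambda>m. fst m = \<beta>) S. f m)"
    using Cons.prems assms(1) by (simp add: sum.distrib)
  finally show ?case using Cons by simp
qed simp

text \<open>\<open>GREATEST\<close> is informative only for a bounded property; the bound is the
  largest weight occurring in the finite list.\<close>

lemma part_zero_above_deg_w:
  assumes "deg_w w S < wt w \<beta>"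
  shows "part_zero S \<beta>"
proof (rule ccontr)
  assume nz: "\<not> part_zero S \<beta>"
  have "filter (\<lambda>m. fst m = \<beta>) (Cdw (wt w \<beta>) w S) = filter (\<lambda>m. fst m = \<beta>) S"
    unfolding Cdw_def filter_filter by (rule filter_cong) auto
  then have "part_zero (Cdw (wt w \<beta>) w S) \<beta> = part_zero S \<beta>"
    by (simp only: part_zero_def)
  then have "\<not> pzero (Cdw (wt w \<beta>) w S)"
    using nz unfolding pzero_def by blast
  moreover have "d \<le> Max (wt w ` fst ` set S)" if "\<not> pzero (Cdw d w S)" for d
  proof -
    have "Cdw d w S \<noteq> []" using that by (auto simp: pzero_def part_zero_def)
    then obtain m where "m \<in> set S" "wt w (fst m) = d"
      unfolding Cdw_def by (auto simp: filter_empty_conv)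
    then show ?thesis by auto
  qed
  ultimately have "wt w \<beta> \<le> deg_w w S"
    unfolding deg_w_def by (intro Greatest_le_nat) auto
  then show False using assms by simp
qed

text \<open>Both \<open>x\<close> in \<open>H\<close> and \<open>p\<close> are arbitrary, so this is
  an identity on all of \<open>H \<times> UNIV\<close> and not merely at the given point.\<close>

lemma abel_Mw_MF_eq_0:
  fixes H :: "(real^'n::finite) set" and ops :: "nat \<Rightarrow> 'n dop"
  assumes H: "open H" "H \<subseteq> K" and ops: "\<And>k. k < N \<Longrightarrow> op_class K (ops k)"
    and wf: "wf_poly N (\<lambda>k. ord K (ops k) = 0) S"
    and van: "\<And>\<psi> y. smooth_on H \<psi> \<Longrightarrow> y \<in> H \<Longrightarrow> poly_apply K ops S \<psi> y = 0"
    and x: "x \<in> H"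
  shows "abel (Mw (\<lambda>k. ord K (ops k)) S) (\<lambda>k. MF K (ops k) x p) = 0"
proof (cases "pzero S")
  case True
  then show ?thesis by (simp add: Mw_def abel_def)
next
  case False
  define w where "w = (\<lambda>k. ord K (ops k))"
  define d where "d = deg_w w S"
  \<comment> \<open>Monomials of weight above \<open>d\<close> may occur in the list although their
    parts vanish formally. Individually they would exceed the degree bound \<open>d\<close>; word by
    word they act as zero, so \<open>T\<close> acts like \<open>S\<close>.\<close>
  define T where "T = filter (\<lambda>m. wt w (fst m) \<le> d) S"
  have wfm: "length (snd m) = Suc (length (fst m))" "\<forall>k\<in>set (fst m). k < N"
    "\<forall>Z\<in>set (snd m). smooth_fin {k. k < N \<and> ord K (ops k) = 0} Z" if "m \<in> set S" for m
    using wf that unfolding wf_poly_def by blast+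
  have T: "(\<Sum>m\<leftarrow>T. mono_apply K ops (fst m) (snd m) \<psi> y) = 0" if \<psi>: "smooth_on H \<psi>" and y: "y \<in> H" for \<psi> y
  proof -
    let ?f = "\<lambda>m. mono_apply K ops (fst m) (snd m) \<psi> y"
    have "(\<Sum>m\<leftarrow>filter (\<lambda>m. fst m = \<beta>) T. ?f m) = (\<Sum>m\<leftarrow>filter (\<lambda>m. fst m = \<beta>) S. ?f m)"
      if "\<beta> \<in> fst ` set S" for \<beta>
    proof (cases "wt w \<beta> \<le> d")
      case True
      then have "filter (\<lambda>m. fst m = \<beta>) T = filter (\<lambda>m. fst m = \<beta>) S"
        unfolding T_def filter_filter by (intro filter_cong) auto
      then show ?thesis by simp
    next
      case False
      then have E: "filter (\<lambda>m. fst m = \<beta>) T = []"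
        unfolding T_def by (auto simp: filter_empty_conv)
      have pz: "part_zero S \<beta>" using False part_zero_above_deg_w[of w S \<beta>] unfolding d_def by simp
      define L where "L = map (\<lambda>m. (1::real, snd m)) (filter (\<lambda>m. fst m = \<beta>) S)"
      have LS: "(\<beta>, Zs) \<in> set S" if "(c, Zs) \<in> set L" for c Zs
        using that unfolding L_def by auto
      have "(\<Sum>(c, Zs)\<leftarrow>L. c * mono_apply K ops \<beta> Zs \<psi> y) = 0"
      proof (rule sum_mono_apply_eq_0[OF H ops \<psi>])
        show "\<forall>k\<in>set \<beta>. k < N" using that wfm(2) by auto
        show "length Zs = Suc (length \<beta>)" if "(c, Zs) \<in> set L" for c Zs
          using wfm(1)[OF LS[OF that]] by simp
        show "smooth_fin {k. k < N \<and> ord K (ops k) = 0} Z" if "(c, Zs) \<in> set L" "Z \<in> set Zs" for c Zs Z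
          using wfm(3)[OF LS[OF that(1)]] that(2) by simp
        show "(\<Sum>(c, Zs)\<leftarrow>L. c * (\<Prod>j<length Zs. (Zs ! j) (g j))) = 0" for g
          using pz unfolding part_zero_def L_def by (simp add: comp_def)
      qed (use y in auto)
      moreover have "(\<Sum>(c, Zs)\<leftarrow>L. c * mono_apply K ops \<beta> Zs \<psi> y) = (\<Sum>m\<leftarrow>filter (\<lambda>m. fst m = \<beta>) S. ?f m)"
        unfolding L_def map_map by (intro arg_cong[of _ _ sum_list] map_cong) auto
      ultimately show ?thesis using E by simp
    qed
    then have "(\<Sum>m\<leftarrow>T. ?f m) = (\<Sum>m\<leftarrow>S. ?f m)"
      using sum_list_group_fst[of "fst ` set S" T ?f] sum_list_group_fst[of "fst ` set S" S ?f]
      by (auto simp: T_def)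
    then show ?thesis using van[OF \<psi> y] unfolding poly_apply_def by simp
  qed
  define lead where "lead m x = (\<Prod>Z\<leftarrow>snd m. Z (\<lambda>k. MF K (ops k) x p)) * (\<Prod>k\<leftarrow>fst m. MF K (ops k) x p)"
    for m :: mono and x
  \<comment> \<open>Monomials of smaller weight are raised to \<open>d\<close> and contribute 0, so
    only the main part survives in the leading coefficient.\<close>
  have "expands H p d (\<lambda>x. \<Sum>m\<leftarrow>ms. if wt w (fst m) = d then lead m x else 0)
      (\<lambda>t x. \<Sum>m\<leftarrow>ms. mono_apply K ops (fst m) (snd m) (\<lambda>x. exp (inner (t *\<^sub>R p) x)) x)"
    if "set ms \<subseteq> set T" for ms
    using that
  proof (induction ms)
    case Nil
    show ?case using expands_0[OF H(1)] by simp
  next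
    case (Cons m ms)
    then have m: "m \<in> set S" "wt w (fst m) \<le> d" by (auto simp: T_def)
    have E: "expands H p (wt w (fst m)) (lead m)
        (\<lambda>t. mono_apply K ops (fst m) (snd m) (\<lambda>x. exp (inner (t *\<^sub>R p) x)))"
      using expands_mono_apply[OF H ops wfm[OF m(1)]] unfolding w_def lead_def[abs_def] by simp
    have "expands H p d (\<lambda>x. if wt w (fst m) = d then lead m x else 0)
        (\<lambda>t. mono_apply K ops (fst m) (snd m) (\<lambda>x. exp (inner (t *\<^sub>R p) x)))"
      using E expands_raise[OF H(1) E, of d] m(2) by (cases "wt w (fst m) = d") auto
    from expands_add[OF H(1) this Cons.IH] Cons.prems show ?case by simp
  qed
  from expands_imp_lead_eq_0[OF this[OF order_refl] x T[OF smooth_on_exp_inner[OF H(1)] x]]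
  have "(\<Sum>m\<leftarrow>T. if wt w (fst m) = d then lead m x else 0) = 0" .
  moreover have "(\<Sum>m\<leftarrow>T. if wt w (fst m) = d then lead m x else 0) = (\<Sum>m\<leftarrow>Cdw d w S. lead m x)"
    unfolding T_def Cdw_def by (induction S) auto
  moreover have "abel (Mw w S) (\<lambda>k. MF K (ops k) x p) = (\<Sum>m\<leftarrow>Cdw d w S. lead m x)"
    using False by (simp add: Mw_def d_def abel_def lead_def)
  ultimately show ?thesis unfolding w_def by simp
qed

section \<open>Continuous differentiability of the abelianization\<close>

text \<open>Just the regularity that the chain rule and the continuity of the Jacobian determinant
  require. The partial derivatives are quantified existentially, so that closure proofs can exhibit
  them; they are identified with \<open>vpd\<close> afterwards.\<close>

definition C1_fin :: "nat set \<Rightarrow> ((nat \<Rightarrow> real) \<Rightarrow> real) \<Rightarrow> bool" where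
  "C1_fin V F \<longleftrightarrow> (\<forall>u v. (\<forall>k\<in>V. u k = v k) \<longrightarrow> F u = F v) \<and> continuous_on UNIV F \<and>
     (\<exists>G. \<forall>k\<in>V. continuous_on UNIV (G k) \<and>
        (\<forall>v. ((\<lambda>t. F (v(k := t))) has_real_derivative G k v) (at (v k))))"

lemma C1_fin_vpd:
  assumes "C1_fin V F" "k \<in> V"
  shows "continuous_on UNIV (vpd k F)" "((\<lambda>t. F (v(k := t))) has_real_derivative vpd k F v) (at (v k))"
proof -
  obtain g where g: "continuous_on UNIV g"
    "\<And>v. ((\<lambda>t. F (v(k := t))) has_real_derivative g v) (at (v k))"
    using assms unfolding C1_fin_def by blast
  have "vpd k F v = g v" for v
    unfolding vpd_def
    using DERIV_shift[of "\<lambda>t. F (v(k := t))" "g v" 0 "v k"] g(2)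
    by (intro DERIV_imp_deriv) (simp add: add.commute)
  then have "vpd k F = g" by auto
  then show "continuous_on UNIV (vpd k F)" "((\<lambda>t. F (v(k := t))) has_real_derivative vpd k F v) (at (v k))"
    using g by auto
qed

lemma C1_fin_const: "C1_fin V (\<lambda>v. c)"
  unfolding C1_fin_def by (auto intro!: exI[of _ "\<lambda>k v. 0"])

lemma C1_fin_coord: "j \<in> V \<Longrightarrow> C1_fin V (\<lambda>v. v j)"
  unfolding C1_fin_def
proof (intro conjI exI[of _ "\<lambda>k v. if k = j then 1 else 0"] ballI allI)
  show "((\<lambda>t. (v(k := t)) j) has_real_derivative (if k = j then 1 else 0)) (at (v k))" for k and v :: "nat \<Rightarrow> real"
    by (cases "k = j") auto
qed (auto intro: continuous_on_product_coordinates)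

lemma C1_fin_add:
  assumes "C1_fin V F" "C1_fin V G"
  shows "C1_fin V (\<lambda>v. F v + G v)"
  unfolding C1_fin_def
proof (intro conjI exI[of _ "\<lambda>k v. vpd k F v + vpd k G v"] ballI allI impI)
  show "F u + G u = F v + G v" if "\<forall>k\<in>V. u k = v k" for u v
    using assms that unfolding C1_fin_def by metis
  show "continuous_on UNIV (\<lambda>v. F v + G v)"
    using assms unfolding C1_fin_def by (intro continuous_on_add) auto
qed (auto intro!: continuous_on_add DERIV_add C1_fin_vpd assms simp del: fun_upd_apply)

lemma C1_fin_mult:
  assumes "C1_fin V F" "C1_fin V G"
  shows "C1_fin V (\<lambda>v. F v * G v)"
  unfolding C1_fin_def
proof (intro conjI exI[of _ "\<lambda>k v. vpd k F v * G v + vpd k G v * F v"] ballI allI impI)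
  have c: "continuous_on UNIV F" "continuous_on UNIV G"
    using assms unfolding C1_fin_def by auto
  show "F u * G u = F v * G v" if "\<forall>k\<in>V. u k = v k" for u v
    using assms that unfolding C1_fin_def by metis
  show "continuous_on UNIV (\<lambda>v. F v * G v)"
    by (intro continuous_on_mult c)
  show "continuous_on UNIV (\<lambda>v. vpd k F v * G v + vpd k G v * F v)" if "k \<in> V" for k
    by (intro continuous_on_add continuous_on_mult c C1_fin_vpd(1)[OF _ that] assms)
  show "((\<lambda>t. F (v(k := t)) * G (v(k := t))) has_real_derivative vpd k F v * G v + vpd k G v * F v) (at (v k))"
    if "k \<in> V" for k v
    using DERIV_mult[OF C1_fin_vpd(2)[OF assms(1) that, of v] C1_fin_vpd(2)[OF assms(2) that, of v]] by simp
qed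

text \<open>The coefficient functions see only the commuting variables, whereas the abelianization
  is a function of all of them; the added variables have partial derivative 0.\<close>

lemma C1_fin_smooth_fin:
  assumes "smooth_fin V' Z" "V' \<subseteq> V"
  shows "C1_fin V Z"
  unfolding C1_fin_def
proof (intro conjI exI[of _ "\<lambda>k v. if k \<in> V' then vpd k Z v else 0"] ballI allI impI)
  show "Z u = Z v" if "\<forall>k\<in>V. u k = v k" for u v
    using assms(2) that by (intro smooth_fin_D(2)[OF assms(1)]) auto
  show "continuous_on UNIV Z" by (rule smooth_fin_D(3)[OF assms(1)])
  show "continuous_on UNIV (\<lambda>v. if k \<in> V' then vpd k Z v else 0)" for k
    using smooth_fin_D(3)[OF smooth_fin_vpd[OF assms(1)]] by (cases "k \<in> V'") auto
  show "((\<lambda>t. Z (v(k := t))) has_real_derivative (if k \<in> V' then vpd k Z v else 0)) (at (v k))" for k v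
  proof (cases "k \<in> V'")
    case True
    then show ?thesis using smooth_fin_D(4)[OF assms(1)] by simp
  next
    case False
    then have "Z (v(k := t)) = Z v" for t by (intro smooth_fin_D(2)[OF assms(1)]) auto
    then show ?thesis using False by simp
  qed
qed

lemma C1_fin_abel:
  assumes "wf_poly N C S"
  shows "C1_fin {..<N} (abel S)"
  using assms
proof (induction S)
  case Nil
  show ?case using C1_fin_const by (simp add: abel_def[abs_def])
next
  case (Cons m S)
  have Z: "\<forall>Z\<in>set Zs. smooth_fin {k. k < N \<and> C k} Z \<Longrightarrow> C1_fin {..<N} (\<lambda>v. \<Prod>Z\<leftarrow>Zs. Z v)" for Zs
  proof (induction Zs)
    case (Cons Z Zs)
    then show ?case
      using C1_fin_mult[OF C1_fin_smooth_fin[of "{k. k < N \<and> C k}" Z "{..<N}"], of "\<lambda>v. \<Prod>Z\<leftarrow>Zs. Z v"] by auto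
  qed (simp add: C1_fin_const)
  have F: "\<forall>k\<in>set bs. k < N \<Longrightarrow> C1_fin {..<N} (\<lambda>v. \<Prod>k\<leftarrow>bs. v k)" for bs
  proof (induction bs)
    case (Cons b bs)
    then show ?case
      using C1_fin_mult[OF C1_fin_coord[of b "{..<N}"], of "\<lambda>v. \<Prod>k\<leftarrow>bs. v k"] by auto
  qed (simp add: C1_fin_const)
  have "C1_fin {..<N} (\<lambda>v. (\<Prod>Z\<leftarrow>snd m. Z v) * (\<Prod>k\<leftarrow>fst m. v k) + abel S v)"
    using Cons by (intro C1_fin_add C1_fin_mult Z F) (auto simp: wf_poly_def)
  then show ?case by (simp add: abel_def[abs_def])
qed

lemma wf_poly_Mw: "wf_poly N C S \<Longrightarrow> wf_poly N C (Mw w S)"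
  unfolding wf_poly_def Mw_def Cdw_def by auto

section \<open>Differentials of main symbols and their spans\<close>

lemma MF_differentiable:
  fixes K :: "(real^'n::finite) set"
  assumes "open K" "op_class K A" "fst z \<in> K"
  shows "(\<lambda>z. MF K A (fst z) (snd z)) differentiable (at z)"
proof -
  have A: "(\<lambda>z. A \<alpha> (fst z)) differentiable (at z)" for \<alpha>
  proof -
    have "A \<alpha> differentiable (at (fst z))"
      using smooth_on_has_derivative[OF assms(1) _ assms(3)] assms(2)
      unfolding op_class_def differentiable_def by blast
    moreover have "(fst :: (real^'n) \<times> (real^'n) \<Rightarrow> _) differentiable (at z)"
      using bounded_linear_fst bounded_linear_imp_differentiable by blast
    ultimately have "A \<alpha> \<circ> fst differentiable (at z)"
      using differentiable_chain_at by blast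
    then show ?thesis by (simp add: comp_def)
  qed
  have P: "(\<lambda>z. snd z $ i) differentiable (at z)" for i
    by (rule bounded_linear_imp_differentiable)
      (intro bounded_linear_compose[OF bounded_linear_vec_nth bounded_linear_snd])
  have "(\<lambda>z. \<Prod>i\<in>I. (snd z $ i) ^ \<alpha> i) differentiable (at z)" if "finite I" for I and \<alpha> :: "'n \<Rightarrow> nat"
    using that by induction (auto intro!: differentiable_mult differentiable_power P)
  then show ?thesis
    unfolding MF_def using assms(2)
    by (intro differentiable_sum ballI differentiable_mult A) (auto simp: op_class_def)
qed

text \<open>The gradient of the main symbol jointly in position and momentum.\<close>

definition dMF :: "(real^'n::finite) set \<Rightarrow> 'n dop \<Rightarrow> (real^'n) \<times> (real^'n) \<Rightarrow> (real^'n) \<times> (real^'n)" where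
  "dMF K A z = (\<Sum>b\<in>Basis. frechet_derivative (\<lambda>z. MF K A (fst z) (snd z)) (at z) b *\<^sub>R b)"

lemma frechet_derivative_MF:
  assumes "open K" "op_class K A" "fst z \<in> K"
  shows "frechet_derivative (\<lambda>z. MF K A (fst z) (snd z)) (at z) v = inner (dMF K A z) v"
  unfolding dMF_def
  by (rule linear_functional_eq_inner)
    (use MF_differentiable[OF assms] linear_frechet_derivative in blast)

lemma has_derivative_MF:
  assumes "open K" "op_class K A" "fst z \<in> K"
  shows "((\<lambda>z. MF K A (fst z) (snd z)) has_derivative (\<lambda>v. inner (dMF K A z) v)) (at z)"
proof -
  have "((\<lambda>z. MF K A (fst z) (snd z)) has_derivative
      frechet_derivative (\<lambda>z. MF K A (fst z) (snd z)) (at z)) (at z)"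
    using MF_differentiable[OF assms] frechet_derivative_works by blast
  moreover have "frechet_derivative (\<lambda>z. MF K A (fst z) (snd z)) (at z) = (\<lambda>v. inner (dMF K A z) v)"
    using frechet_derivative_MF[OF assms] by blast
  ultimately show ?thesis by simp
qed

lemma alg_dep_imp_dMF_in_span:
  fixes K :: "(real^'n::finite) set"
  assumes K: "open K" and x: "x \<in> K"
    and W: "\<And>i. i < s \<Longrightarrow> op_class K (W i)" and Y: "\<And>k. k < r \<Longrightarrow> op_class K (Y k)"
    and dep: "alg_dep K s W r Y x p"
  shows "\<exists>U. open U \<and> (x, p) \<in> U \<and> U \<subseteq> K \<times> UNIV \<and>
    (\<forall>z\<in>U. \<forall>i<s. dMF K (W i) z \<in> span ((\<lambda>k. dMF K (Y k) z) ` {..<r}))"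
proof -
  define ops where "ops = tcat s W Y"
  define w where "w = (\<lambda>k. ord K (ops k))"
  define vb where "vb z = (\<lambda>k. MF K (ops k) (fst z) (snd z))" for z
  have ops: "op_class K (ops k)" if "k < s + r" for k
    using that W Y by (auto simp: ops_def tcat_def)
  obtain S H where wf: "\<And>i. i < s \<Longrightarrow> wf_poly (s + r) (\<lambda>k. ord K (ops k) = 0) (S i)"
    and det: "detn s (\<lambda>i j. vpd j (abel (Mw w (S i))) (vb (x, p))) \<noteq> 0"
    and H: "open H" "x \<in> H" "H \<subseteq> K"
    and van: "\<And>\<psi> i y. smooth_on H \<psi> \<Longrightarrow> i < s \<Longrightarrow> y \<in> H \<Longrightarrow> poly_apply K ops (S i) \<psi> y = 0"
    using dep unfolding alg_dep_def Let_def ops_def[symmetric] w_def vb_def fst_conv snd_conv by blast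
  define F where "F i = abel (Mw w (S i))" for i
  have C1: "C1_fin {..<s + r} (F i)" if "i < s" for i
    unfolding F_def by (intro C1_fin_abel[where C = "\<lambda>k. ord K (ops k) = 0"] wf_poly_Mw wf that)
  define U0 where "U0 = H \<times> (UNIV :: (real^'n) set)"
  have U0: "open U0" "(x, p) \<in> U0" "\<And>z. z \<in> U0 \<Longrightarrow> fst z \<in> K" "\<And>z. z \<in> U0 \<Longrightarrow> fst z \<in> H"
    using H by (auto simp: U0_def open_Times)
  have hd: "((\<lambda>z. vb z k) has_derivative (\<lambda>v. inner (dMF K (ops k) z) v)) (at z)" if "k < s + r" "z \<in> U0" for k z
    unfolding vb_def using has_derivative_MF[OF K ops[OF that(1)] U0(3)[OF that(2)]] .
  have dep: "F i u = F i v" if "i < s" "\<forall>k\<in>{..<s + r}. u k = v k" for i u v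
    using C1[OF that(1)] that(2) unfolding C1_fin_def by blast
  have rel: "(\<Sum>k<s + r. vpd k (F i) (vb z) *\<^sub>R dMF K (ops k) z) = 0" if i: "i < s" and z: "z \<in> U0" for i z
  proof -
    have "((\<lambda>z. F i (\<lambda>k. vb z k)) has_derivative
        (\<lambda>h. \<Sum>k<s + r. vpd k (F i) (\<lambda>k. vb z k) * inner (dMF K (ops k) z) h)) (at z)"
      by (rule has_derivative_compose_partials[where N = UNIV and V = "\<lambda>k z. vb z k"])
        (use dep[OF i] C1_fin_vpd[OF C1[OF i]] hd z in \<open>auto simp del: fun_upd_apply\<close>)
    \<comment> \<open>The composite is identically 0 on the open set \<open>U0\<close>, so
      uniqueness of the derivative turns the chain rule into a linear relation between the
      gradients.\<close>
    from has_derivative_unique[OF this]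
    have "(\<lambda>h. \<Sum>k<s + r. vpd k (F i) (vb z) * inner (dMF K (ops k) z) h) = (\<lambda>h. 0)"
      if "((\<lambda>z. F i (\<lambda>k. vb z k)) has_derivative (\<lambda>h. 0)) (at z)"
      using that by simp
    moreover have "((\<lambda>z. F i (\<lambda>k. vb z k)) has_derivative (\<lambda>h. 0)) (at z)"
    proof (rule has_derivative_transform_within_open[OF has_derivative_const U0(1) z])
      fix z' assume "z' \<in> U0"
      then have "abel (Mw (\<lambda>k. ord K (ops k)) (S i)) (\<lambda>k. MF K (ops k) (fst z') (snd z')) = 0"
        by (intro abel_Mw_MF_eq_0[OF H(1,3) ops wf[OF i]] van i U0(4)) auto
      then show "0 = F i (\<lambda>k. vb z' k)" by (simp add: F_def w_def vb_def)
    qed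
    ultimately have "(\<lambda>h. \<Sum>k<s + r. vpd k (F i) (vb z) * inner (dMF K (ops k) z) h) = (\<lambda>h. 0)"
      by blast
    from fun_cong[OF this]
    have "inner (\<Sum>k<s + r. vpd k (F i) (vb z) *\<^sub>R dMF K (ops k) z) h = 0" for h
      by (simp add: inner_sum_left)
    then show ?thesis using inner_eq_zero_iff by blast
  qed
  define D where "D z = detn s (\<lambda>i j. vpd j (F i) (vb z))" for z
  have "continuous_on U0 D"
  proof -
    \<comment> \<open>Beyond \<open>s + r\<close> the entries of \<open>ops\<close> are
      unconstrained, and continuity of \<open>vb\<close> in the product topology would need all
      coordinates. Cutting them off at 0 changes no derivative of \<open>F i\<close>, which depends
      only on the first \<open>s + r\<close> variables.\<close>
    define vb' where "vb' z = (\<lambda>k. if k < s + r then vb z k else 0)" for z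
    have cvb: "continuous_on U0 vb'"
    proof (rule continuous_on_coordinatewise_then_product)
      fix k
      show "continuous_on U0 (\<lambda>z. vb' z k)"
        using has_derivative_continuous[OF hd[of k]]
        by (cases "k < s + r") (auto simp: vb'_def intro!: continuous_at_imp_continuous_on)
    qed
    have "vpd j (F i) (vb z) = vpd j (F i) (vb' z)" if "i < s" "j < s" for i j z
    proof -
      have "F i ((vb z)(j := vb z j + t)) = F i ((vb' z)(j := vb' z j + t))" for t
        using that by (intro dep) (auto simp: vb'_def)
      then show ?thesis unfolding vpd_def by simp
    qed
    moreover have "continuous_on U0 (\<lambda>z. vpd j (F i) (vb' z))" if "i < s" "j < s" for i j
      using that by (intro continuous_on_compose2[OF C1_fin_vpd(1)[OF C1] cvb]) auto
    ultimately have "continuous_on U0 (\<lambda>z. vpd j (F i) (vb z))" if "i < s" "j < s" for i j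
      using that by simp
    then show ?thesis
      unfolding D_def[abs_def] detn_def
      by (intro continuous_on_sum continuous_on_mult continuous_on_const continuous_on_prod)
        (auto dest: permutes_in_image)
  qed
  then have "open (U0 \<inter> D -` (- {0}))"
    using U0(1) by (intro continuous_open_preimage) auto
  moreover have "(x, p) \<in> U0 \<inter> D -` (- {0})"
    using U0(2) det by (simp add: D_def F_def)
  moreover have "U0 \<inter> D -` (- {0}) \<subseteq> K \<times> UNIV"
    using U0(3) by auto
  moreover have "dMF K (W i) z \<in> span ((\<lambda>k. dMF K (Y k) z) ` {..<r})"
    if z: "z \<in> U0 \<inter> D -` (- {0})" and i: "i < s" for z i
  proof (rule detn_nonzero_imp_in_span[OF _ _ i, of "\<lambda>i j. vpd j (F i) (vb z)"])
    show "detn s (\<lambda>i j. vpd j (F i) (vb z)) \<noteq> 0" using z by (simp add: D_def)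
    fix i assume i: "i < s"
    let ?a = "\<lambda>k. vpd k (F i) (vb z) *\<^sub>R dMF K (ops k) z"
    have "(\<Sum>k<s + r. ?a k) = (\<Sum>k<s. ?a k) + (\<Sum>k<r. ?a (s + k))"
    proof -
      have "(\<Sum>k<s + r. ?a k) = (\<Sum>k<s. ?a k) + (\<Sum>k\<in>{s..<s + r}. ?a k)"
        by (simp add: lessThan_atLeast0 sum.atLeastLessThan_concat)
      also have "(\<Sum>k\<in>{s..<s + r}. ?a k) = (\<Sum>k<r. ?a (s + k))"
        using sum.shift_bounds_nat_ivl[of ?a 0 s r] by (simp add: lessThan_atLeast0 add.commute)
      finally show ?thesis .
    qed
    then have "(\<Sum>k<s. ?a k) = - (\<Sum>k<r. ?a (s + k))"
      using rel[OF i, of z] z by (simp add: eq_neg_iff_add_eq_0)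
    moreover have "(\<Sum>k<s. ?a k) = (\<Sum>k<s. vpd k (F i) (vb z) *\<^sub>R dMF K (W k) z)"
      by (simp add: ops_def tcat_def)
    moreover have "(\<Sum>k<r. ?a (s + k)) = (\<Sum>k<r. vpd (s + k) (F i) (vb z) *\<^sub>R dMF K (Y k) z)"
      by (simp add: ops_def tcat_def)
    ultimately have "(\<Sum>j<s. vpd j (F i) (vb z) *\<^sub>R dMF K (W j) z) =
        - (\<Sum>k<r. vpd (s + k) (F i) (vb z) *\<^sub>R dMF K (Y k) z)" by simp
    also have "\<dots> \<in> span ((\<lambda>k. dMF K (Y k) z) ` {..<r})"
      by (intro span_neg span_sum span_scale span_base imageI)
    finally show "(\<Sum>j<s. vpd j (F i) (vb z) *\<^sub>R dMF K (W j) z) \<in> span ((\<lambda>k. dMF K (Y k) z) ` {..<r})" .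
  qed
  ultimately show ?thesis by blast
qed

text \<open>Each link has its own neighborhood, and finitely many are intersected. The intermediate
  tuples may have any length: only the final span, generated by \<open>r\<close> gradients, remains.
  The first link is peeled off, hence the induction over arbitrary \<open>s\<close> and
  \<open>W\<close>.\<close>

lemma alg_chain_imp_dMF_in_span:
  fixes K :: "(real^'n::finite) set"
  assumes K: "open K" and x: "x \<in> K"
    and W: "\<And>i. i < s \<Longrightarrow> op_class K (W i)" and Y: "\<And>k. k < r \<Longrightarrow> op_class K (Y k)"
    and ts: "\<And>t k. t \<in> set ts \<Longrightarrow> k < fst t \<Longrightarrow> op_class K (snd t k)"
    and ch: "\<And>i. i < length ts + 1 \<Longrightarrow>
      alg_dep K (fst (((s, W) # ts @ [(r, Y)]) ! i)) (snd (((s, W) # ts @ [(r, Y)]) ! i))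
        (fst (((s, W) # ts @ [(r, Y)]) ! Suc i)) (snd (((s, W) # ts @ [(r, Y)]) ! Suc i)) x p"
  shows "\<exists>U. open U \<and> (x, p) \<in> U \<and> U \<subseteq> K \<times> UNIV \<and>
    (\<forall>z\<in>U. \<forall>i<s. dMF K (W i) z \<in> span ((\<lambda>k. dMF K (Y k) z) ` {..<r}))"
  using W ts ch
proof (induction ts arbitrary: s W)
  case Nil
  then show ?case using alg_dep_imp_dMF_in_span[OF K x _ Y, of s W] by force
next
  case (Cons t ts)
  obtain s' W' where t: "t = (s', W')" by force
  have W': "op_class K (W' k)" if "k < s'" for k using Cons.prems(2)[of t k] that t by simp
  have "alg_dep K s W s' W' x p" using Cons.prems(3)[of 0] t by simp
  from alg_dep_imp_dMF_in_span[OF K x Cons.prems(1) W' this]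
  obtain U1 where U1: "open U1" "(x, p) \<in> U1" "U1 \<subseteq> K \<times> UNIV"
    "\<And>z i. z \<in> U1 \<Longrightarrow> i < s \<Longrightarrow> dMF K (W i) z \<in> span ((\<lambda>k. dMF K (W' k) z) ` {..<s'})" by blast
  have "\<exists>U. open U \<and> (x, p) \<in> U \<and> U \<subseteq> K \<times> UNIV \<and>
    (\<forall>z\<in>U. \<forall>i<s'. dMF K (W' i) z \<in> span ((\<lambda>k. dMF K (Y k) z) ` {..<r}))"
  proof (rule Cons.IH[OF W'])
    show "op_class K (snd t' k)" if "t' \<in> set ts" "k < fst t'" for t' k
      using Cons.prems(2)[of t' k] that by simp
    show "alg_dep K (fst (((s', W') # ts @ [(r, Y)]) ! i)) (snd (((s', W') # ts @ [(r, Y)]) ! i))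
        (fst (((s', W') # ts @ [(r, Y)]) ! Suc i)) (snd (((s', W') # ts @ [(r, Y)]) ! Suc i)) x p"
      if "i < length ts + 1" for i
      using Cons.prems(3)[of "Suc i"] that t by simp
  qed
  then obtain U2 where U2: "open U2" "(x, p) \<in> U2"
    "\<And>z i. z \<in> U2 \<Longrightarrow> i < s' \<Longrightarrow> dMF K (W' i) z \<in> span ((\<lambda>k. dMF K (Y k) z) ` {..<r})" by blast
  have "dMF K (W i) z \<in> span ((\<lambda>k. dMF K (Y k) z) ` {..<r})" if "z \<in> U1 \<inter> U2" "i < s" for z i
  proof -
    have "span ((\<lambda>k. dMF K (W' k) z) ` {..<s'}) \<subseteq> span ((\<lambda>k. dMF K (Y k) z) ` {..<r})"
      by (intro span_minimal subspace_span) (use U2(3)[of z] that in auto)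
    then show ?thesis using U1(4)[of z i] that by blast
  qed
  then show ?case using U1 U2 by (intro exI[of _ "U1 \<inter> U2"]) auto
qed

theorem theorem3p35:
  fixes K :: "(real^'n::finite) set" and s :: nat and W :: "nat \<Rightarrow> 'n dop"
    and xbar pbar :: "real^'n"
  assumes "open K"
    and "\<forall>i<s. op_class K (W i)"
    and "xbar \<in> K"
    and "reg_dep K s W xbar pbar"
  shows "(\<exists>U. open U \<and> (xbar, pbar) \<in> U \<and> U \<subseteq> K \<times> UNIV \<and>
            (\<forall>z\<in>U. \<not> quasi_indep K s W (fst z) (snd z)))
         \<and> \<not> glob_quasi_indep K s W"
proof -
  obtain r Y ts where r: "r < s" and Y: "\<And>k. k < r \<Longrightarrow> op_class K (Y k)"
    and ts: "\<And>t k. t \<in> set ts \<Longrightarrow> k < fst t \<Longrightarrow> op_class K (snd t k)"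
    and ch: "\<And>i. i < length ts + 1 \<Longrightarrow>
      alg_dep K (fst (((s, W) # ts @ [(r, Y)]) ! i)) (snd (((s, W) # ts @ [(r, Y)]) ! i))
        (fst (((s, W) # ts @ [(r, Y)]) ! Suc i)) (snd (((s, W) # ts @ [(r, Y)]) ! Suc i)) xbar pbar"
    using assms(4) unfolding reg_dep_def alg_contained_def Let_def by blast
  obtain U where U: "open U" "(xbar, pbar) \<in> U" "U \<subseteq> K \<times> UNIV"
    and sp: "\<And>z i. z \<in> U \<Longrightarrow> i < s \<Longrightarrow> dMF K (W i) z \<in> span ((\<lambda>k. dMF K (Y k) z) ` {..<r})"
    using alg_chain_imp_dMF_in_span[OF assms(1,3) _ Y ts ch] assms(2) by blast
  have nq: "\<not> quasi_indep K s W (fst z) (snd z)" if z: "z \<in> U" for z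
  proof -
    have "card ((\<lambda>k. dMF K (Y k) z) ` {..<r}) < s"
      using card_image_le[of "{..<r}" "\<lambda>k. dMF K (Y k) z"] r by simp
    then obtain c where c: "\<exists>i<s. c i \<noteq> 0" "(\<Sum>i<s. c i *\<^sub>R dMF K (W i) z) = 0"
      using ex_linear_dependence_in_span[of "(\<lambda>k. dMF K (Y k) z) ` {..<r}" s "\<lambda>i. dMF K (W i) z"] sp[OF z]
      by auto
    have "(\<Sum>i<s. c i * frechet_derivative (\<lambda>z. MF K (W i) (fst z) (snd z)) (at z) v) = 0" for v
    proof -
      have "frechet_derivative (\<lambda>z. MF K (W i) (fst z) (snd z)) (at z) v = inner (dMF K (W i) z) v"
        if "i < s" for i
        using assms(2) that U(3) z by (intro frechet_derivative_MF[OF assms(1)]) auto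
      then have "(\<Sum>i<s. c i * frechet_derivative (\<lambda>z. MF K (W i) (fst z) (snd z)) (at z) v) =
          inner (\<Sum>i<s. c i *\<^sub>R dMF K (W i) z) v"
        by (simp add: inner_sum_left)
      then show ?thesis using c(2) by simp
    qed
    then show ?thesis using c(1) unfolding quasi_indep_def by auto
  qed
  have "\<not> glob_quasi_indep K s W"
  proof
    assume "glob_quasi_indep K s W"
    then have "AE z in lborel. z \<notin> U"
      unfolding glob_quasi_indep_def by (rule eventually_mono) (use nq U(3) in blast)
    then have "U \<in> null_sets lborel"
      using U(1) by (subst AE_iff_null_sets) auto
    \<comment> \<open>A nonempty open set is never negligible, which contradicts quasi-independence
      almost everywhere.\<close>
    then have "negligible U"
      using null_sets_completionI negligible_iff_null_sets by blast
    then show False using open_not_negligible U(1,2) by blast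
  qed
  then show ?thesis using U nq by blast
qed

end
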